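(* Let $(W,S)$ be a Coxeter group with length function $l$, let $*:W\to W$, $w\mapsto w^*$, be a group automorphism with $S^*=S$ and $*^2=1$, and let $\mathbf I_*=\{w\in W: w^*=w^{-1}\}$. Let $\mathfrak H$, $\hat{\mathfrak H}$, the $\mathfrak H$-module $M$ with basis $\{a_w: w\in\mathbf I_*\}$, and $X=\sum_{x\in W;\,x^*=x}u^{-l(x)}T_x\in\hat{\mathfrak H}$ be as defined in the context. Then: (a) There exists a unique $\mathfrak H$-linear map $\mu:M\to\hat{\mathfrak H}$ such that $\mu(a_1)=X$. Moreover, $\mu$ is an isomorphism of $M$ onto the $\mathfrak H$-submodule of $\hat{\mathfrak H}$ generated by $X$. (b) For $z\in\mathbf I_*$ write $\mu(a_z)=\sum_{x\in W}N^x_zT_x$ with $N^x_z\in\mathbf Q(u)$. Then for any $x\in W$ we have $N^x_z\in\mathbf Z[u^{-1}]$; hence one can define $n^x_z=N^x_z|_{u^{-1}=0}\in\mathbf Z$. (c) There is a unique surjective function $\pi:W\to\mathbf I_*$ such that for all $x\in W$, $z\in\mathbf I_*$ we have $n^x_z=1$ if $z=\pi(x)$ and $n^x_z=0$ if $z\neq\pi(x)$.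
   Context: Let $u$ be an indeterminate. $\mathfrak H$ is the $\mathbf Q(u)$-vector space with basis $\{T_w:w\in W\}$, made into an associative unital $\mathbf Q(u)$-algebra by $T_wT_{w'}=T_{ww'}$ if $l(ww')=l(w)+l(w')$, and $(T_s+1)(T_s-u^2)=0$ for $s\in S$. $\hat{\mathfrak H}$ is the $\mathbf Q(u)$-vector space of all formal (possibly infinite) sums $\sum_{x\in W}c_xT_x$ with $c_x\in\mathbf Q(u)$. It contains $\mathfrak H$, and left multiplication of $\mathfrak H$ on itself extends in the obvious way to an $\mathfrak H$-module structure on $\hat{\mathfrak H}$ (each $T_s$ acts by applying the formula for $T_sT_x$ term by term; each coefficient of the result is a finite sum). For $x,y\in W$ with $y^{-1}x\in S$ or $xy^{-1}\in S$, write $x<y$ (or $y>x$) if $l(x)=l(y)-1$. $M$ is the $\mathbf Q(u)$-vector space with basis $\{a_w:w\in\mathbf I_*\}$. It is an $\mathfrak H$-module (this is known) in which, for $s\in S$, $w\in\mathbf I_*$: - $T_sa_w=ua_w+(u+1)a_{sw}$ if $sw=ws^*$ and $sw>w$; - $T_sa_w=(u^2-u-1)a_w+(u^2-u)a_{sw}$ if $sw=ws^*$ and $sw<w$; - $T_sa_w=a_{sws^*}$ if $sw\ne ws^*$ and $sw>w$; - $T_sa_w=(u^2-1)a_w+u^2a_{sws^*}$ if $sw\ne ws^*$ and $sw<w$. *)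

theory Defs
  imports
    "HOL-Algebra.Multiplicative_Group"
    "HOL-Computational_Algebra.Fraction_Field"
    "HOL-Computational_Algebra.Polynomial"
    "HOL-Library.FuncSet"
    "HOL-Library.Function_Algebras"
begin

section \<open>Coxeter groups\<close>

definition word_prod :: "('w, 'b) monoid_scheme \<Rightarrow> 'w list \<Rightarrow> 'w" where
  "word_prod W ws = foldr (\<otimes>\<^bsub>W\<^esub>) ws \<one>\<^bsub>W\<^esub>"

text \<open>
  The congruence on words in the letters \<open>S\<close> generated by the relations
  \<open>(s t)\<^bsup>m(s,t)\<^esup> = 1\<close>, where \<open>m(s,t)\<close> is the order of \<open>s t\<close>; the function \<^const>\<open>group.ord\<close> is \<open>0\<close> on
  elements of infinite order, and those impose no relation.  The case \<open>s = t\<close> is the relation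
  \<open>s s = 1\<close>, so that formal inverses of letters are not needed and the quotient of
  the free monoid on \<open>S\<close> is the group with this presentation.
\<close>

inductive coxeter_cong :: "('w, 'b) monoid_scheme \<Rightarrow> 'w set \<Rightarrow> 'w list \<Rightarrow> 'w list \<Rightarrow> bool"
  for W (structure) and S where
  rel: "\<lbrakk>s \<in> S; t \<in> S; group.ord W (s \<otimes> t) \<noteq> 0; xs \<in> lists S; ys \<in> lists S\<rbrakk> \<Longrightarrow>
     coxeter_cong W S (xs @ concat (replicate (group.ord W (s \<otimes> t)) [s, t]) @ ys) (xs @ ys)"
| refl: "xs \<in> lists S \<Longrightarrow> coxeter_cong W S xs xs"
| sym: "coxeter_cong W S xs ys \<Longrightarrow> coxeter_cong W S ys xs"
| trans: "\<lbrakk>coxeter_cong W S xs ys; coxeter_cong W S ys zs\<rbrakk> \<Longrightarrow> coxeter_cong W S xs zs"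

locale coxeter_system = group W for W (structure) +
  fixes S
  assumes S_subset: "S \<subseteq> carrier W"
    and ord_S: "s \<in> S \<Longrightarrow> ord s = 2"
    and generate_S: "generate W S = carrier W"
    and presentation: "\<lbrakk>xs \<in> lists S; ys \<in> lists S; word_prod W xs = word_prod W ys\<rbrakk> \<Longrightarrow>
          coxeter_cong W S xs ys"

definition cox_length :: "('w, 'b) monoid_scheme \<Rightarrow> 'w set \<Rightarrow> 'w \<Rightarrow> nat" where
  "cox_length W S w = (LEAST n. \<exists>ws \<in> lists S. length ws = n \<and> word_prod W ws = w)"

definition cox_less :: "('w, 'b) monoid_scheme \<Rightarrow> 'w set \<Rightarrow> 'w \<Rightarrow> 'w \<Rightarrow> bool" where
  "cox_less W S x y \<longleftrightarrow>
     (inv\<^bsub>W\<^esub> y \<otimes>\<^bsub>W\<^esub> x \<in> S \<or> x \<otimes>\<^bsub>W\<^esub> inv\<^bsub>W\<^esub> y \<in> S) \<and>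
     cox_length W S y = cox_length W S x + 1"

definition twisted_involutions :: "('w, 'b) monoid_scheme \<Rightarrow> ('w \<Rightarrow> 'w) \<Rightarrow> 'w set" where
  "twisted_involutions W star = {w \<in> carrier W. star w = inv\<^bsub>W\<^esub> w}"


section \<open>Vector spaces over the field of rational functions\<close>

type_synonym Qu = "rat poly fract"

definition u :: Qu where
  "u = Fract [:0, 1:] 1"

text \<open>
  A formal sum \<open>\<Sum>x. c x T\<^sub>x\<close> is represented by its coefficient function, which vanishes outside
  the index set; addition and zero are pointwise (\<^theory>\<open>HOL-Library.Function_Algebras\<close>).
  The pointwise multiplication of that theory is never used.
\<close>

definition formal_sums :: "'i set \<Rightarrow> ('i \<Rightarrow> Qu) set" where
  "formal_sums I = {f. \<forall>x. x \<notin> I \<longrightarrow> f x = 0}"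

definition finite_sums :: "'i set \<Rightarrow> ('i \<Rightarrow> Qu) set" where
  "finite_sums I = {f \<in> formal_sums I. finite {x. f x \<noteq> 0}}"

definition scal :: "Qu \<Rightarrow> ('i \<Rightarrow> Qu) \<Rightarrow> 'i \<Rightarrow> Qu" (infixr \<open>*q\<close> 75) where
  "c *q f = (\<lambda>x. c * f x)"

text \<open>\<open>bvec w\<close> is \<open>T\<^sub>w\<close> in the Hecke algebra and \<open>a\<^sub>w\<close> in the module spanned by the twisted involutions.\<close>

definition bvec :: "'i \<Rightarrow> 'i \<Rightarrow> Qu" where
  "bvec w = (\<lambda>x. if x = w then 1 else 0)"


section \<open>The Hecke algebra and its modules\<close>

definition hecke_algebra ::
    "('w, 'b) monoid_scheme \<Rightarrow> 'w set \<Rightarrow> ('w \<Rightarrow> Qu, 'c) ring_scheme \<Rightarrow> bool" where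
  "hecke_algebra W S H \<longleftrightarrow>
     ring H \<and>
     carrier H = finite_sums (carrier W) \<and>
     (\<forall>h\<in>carrier H. \<forall>k\<in>carrier H. h \<oplus>\<^bsub>H\<^esub> k = h + k) \<and>
     (\<forall>c. \<forall>h\<in>carrier H. \<forall>k\<in>carrier H.
        (c *q h) \<otimes>\<^bsub>H\<^esub> k = c *q (h \<otimes>\<^bsub>H\<^esub> k) \<and> h \<otimes>\<^bsub>H\<^esub> (c *q k) = c *q (h \<otimes>\<^bsub>H\<^esub> k)) \<and>
     (\<forall>w\<in>carrier W. \<forall>w'\<in>carrier W.
        cox_length W S (w \<otimes>\<^bsub>W\<^esub> w') = cox_length W S w + cox_length W S w' \<longrightarrow>
        bvec w \<otimes>\<^bsub>H\<^esub> bvec w' = bvec (w \<otimes>\<^bsub>W\<^esub> w')) \<and>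
     (\<forall>s\<in>S. (bvec s \<oplus>\<^bsub>H\<^esub> \<one>\<^bsub>H\<^esub>) \<otimes>\<^bsub>H\<^esub> (bvec s \<ominus>\<^bsub>H\<^esub> (u\<^sup>2 *q \<one>\<^bsub>H\<^esub>)) = \<zero>\<^bsub>H\<^esub>)"

text \<open>
  The action of the Hecke algebra on formal sums: \<open>h \<cdot> (\<Sum>y. f y T\<^sub>y) = \<Sum>y. f y (h T\<^sub>y)\<close>, computed
  coefficientwise.  For given \<open>h\<close> and \<open>x\<close> only finitely many \<open>h T\<^sub>y\<close> involve \<open>T\<^sub>x\<close>, so the sum below is
  over a finite set.
\<close>

definition hat_act ::
    "('w, 'b) monoid_scheme \<Rightarrow> ('w \<Rightarrow> Qu, 'c) ring_scheme \<Rightarrow> ('w \<Rightarrow> Qu) \<Rightarrow> ('w \<Rightarrow> Qu) \<Rightarrow> 'w \<Rightarrow> Qu" where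
  "hat_act W H h f =
     (\<lambda>x. \<Sum>y | y \<in> carrier W \<and> (h \<otimes>\<^bsub>H\<^esub> bvec y) x \<noteq> 0. f y * (h \<otimes>\<^bsub>H\<^esub> bvec y) x)"

definition hecke_module ::
    "('w \<Rightarrow> Qu, 'c) ring_scheme \<Rightarrow> ('i \<Rightarrow> Qu) set \<Rightarrow> (('w \<Rightarrow> Qu) \<Rightarrow> ('i \<Rightarrow> Qu) \<Rightarrow> 'i \<Rightarrow> Qu) \<Rightarrow> bool" where
  "hecke_module H V act \<longleftrightarrow>
     (\<forall>h\<in>carrier H. \<forall>v\<in>V. act h v \<in> V) \<and>
     (\<forall>h\<in>carrier H. \<forall>v\<in>V. \<forall>v'\<in>V. act h (v + v') = act h v + act h v') \<and>
     (\<forall>h\<in>carrier H. \<forall>k\<in>carrier H. \<forall>v\<in>V. act (h \<oplus>\<^bsub>H\<^esub> k) v = act h v + act k v) \<and>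
     (\<forall>h\<in>carrier H. \<forall>k\<in>carrier H. \<forall>v\<in>V. act (h \<otimes>\<^bsub>H\<^esub> k) v = act h (act k v)) \<and>
     (\<forall>v\<in>V. act \<one>\<^bsub>H\<^esub> v = v) \<and>
     (\<forall>c. \<forall>h\<in>carrier H. \<forall>v\<in>V. act (c *q h) v = c *q act h v \<and> act h (c *q v) = c *q act h v)"

definition involution_module ::
    "('w, 'b) monoid_scheme \<Rightarrow> 'w set \<Rightarrow> ('w \<Rightarrow> 'w) \<Rightarrow> ('w \<Rightarrow> Qu, 'c) ring_scheme \<Rightarrow>
     (('w \<Rightarrow> Qu) \<Rightarrow> ('w \<Rightarrow> Qu) \<Rightarrow> 'w \<Rightarrow> Qu) \<Rightarrow> bool" where
  "involution_module W S star H act \<longleftrightarrow>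
     hecke_module H (finite_sums (twisted_involutions W star)) act \<and>
     (\<forall>s\<in>S. \<forall>w\<in>twisted_involutions W star.
        let sw = s \<otimes>\<^bsub>W\<^esub> w; ws' = w \<otimes>\<^bsub>W\<^esub> star s; sws' = s \<otimes>\<^bsub>W\<^esub> w \<otimes>\<^bsub>W\<^esub> star s in
        (sw = ws' \<and> cox_less W S w sw \<longrightarrow>
           act (bvec s) (bvec w) = u *q bvec w + (u + 1) *q bvec sw) \<and>
        (sw = ws' \<and> cox_less W S sw w \<longrightarrow>
           act (bvec s) (bvec w) = (u\<^sup>2 - u - 1) *q bvec w + (u\<^sup>2 - u) *q bvec sw) \<and>
        (sw \<noteq> ws' \<and> cox_less W S w sw \<longrightarrow>
           act (bvec s) (bvec w) = bvec sws') \<and>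
        (sw \<noteq> ws' \<and> cox_less W S sw w \<longrightarrow>
           act (bvec s) (bvec w) = (u\<^sup>2 - 1) *q bvec w + u\<^sup>2 *q bvec sws'))"

definition hecke_submodule ::
    "('w \<Rightarrow> Qu, 'c) ring_scheme \<Rightarrow> ('i \<Rightarrow> Qu) set \<Rightarrow> (('w \<Rightarrow> Qu) \<Rightarrow> ('i \<Rightarrow> Qu) \<Rightarrow> 'i \<Rightarrow> Qu) \<Rightarrow>
     ('i \<Rightarrow> Qu) set \<Rightarrow> bool" where
  "hecke_submodule H V act U \<longleftrightarrow>
     U \<subseteq> V \<and> 0 \<in> U \<and> (\<forall>v\<in>U. \<forall>v'\<in>U. v + v' \<in> U) \<and> (\<forall>h\<in>carrier H. \<forall>v\<in>U. act h v \<in> U)"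

text \<open>
  Linear maps are extensional functions, so that uniqueness of such a map means
  uniqueness on its domain.  Linearity over the scalars is the case \<open>h = c *q 1\<close> of the last clause.
\<close>

definition hecke_linear_maps ::
    "('w \<Rightarrow> Qu, 'c) ring_scheme \<Rightarrow>
     ('i \<Rightarrow> Qu) set \<Rightarrow> (('w \<Rightarrow> Qu) \<Rightarrow> ('i \<Rightarrow> Qu) \<Rightarrow> 'i \<Rightarrow> Qu) \<Rightarrow>
     ('j \<Rightarrow> Qu) set \<Rightarrow> (('w \<Rightarrow> Qu) \<Rightarrow> ('j \<Rightarrow> Qu) \<Rightarrow> 'j \<Rightarrow> Qu) \<Rightarrow>
     (('i \<Rightarrow> Qu) \<Rightarrow> ('j \<Rightarrow> Qu)) set" where
  "hecke_linear_maps H V actV V' actV' =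
     {\<mu> \<in> V \<rightarrow>\<^sub>E V'.
        (\<forall>v\<in>V. \<forall>v'\<in>V. \<mu> (v + v') = \<mu> v + \<mu> v') \<and>
        (\<forall>h\<in>carrier H. \<forall>v\<in>V. \<mu> (actV h v) = actV' h (\<mu> v))}"

definition X_elt :: "('w, 'b) monoid_scheme \<Rightarrow> 'w set \<Rightarrow> ('w \<Rightarrow> 'w) \<Rightarrow> 'w \<Rightarrow> Qu" where
  "X_elt W S star =
     (\<lambda>x. if x \<in> carrier W \<and> star x = x then inverse u ^ cox_length W S x else 0)"


section \<open>Integral polynomials in the inverse of the indeterminate\<close>

definition int_poly_uinv :: "int poly \<Rightarrow> Qu" where
  "int_poly_uinv p = poly (map_poly of_int p) (inverse u)"

definition Z_uinv :: "Qu set" where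
  "Z_uinv = range int_poly_uinv"

text \<open>Since \<open>u\<close> is transcendental, \<^const>\<open>int_poly_uinv\<close> is injective, and \<open>eval_uinv_0 c\<close> is well defined
  for \<open>c \<in> Z_uinv\<close>.\<close>

definition eval_uinv_0 :: "Qu \<Rightarrow> int" where
  "eval_uinv_0 c = poly (THE p. int_poly_uinv p = c) 0"

end

(* Put phi(v) = coefficient of a_1 in v. The symmetric trace form of the Hecke algebra forces
   mu(v)_x = u^(-2 l(x)) phi(T_(x^-1) v), which is H-linear for any functional phi, so the point is
   that mu(a_1) = X, i.e. phi(T_x a_1) = u^l(x) if x* = x and 0 otherwise. The field Q(u) is ordered
   with u infinitely large; by positivity the support of T_x a_1 lies in that of T_x T_(x*^-1), and
   this gives the vanishing. If x* = x has a left descent s, write x = d y with d in the parabolic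
   subgroup of J = {s, s*} and y of minimal length in its coset: then phi(T_x a_1) =
   phi(T_d a_1) phi(T_y a_1), and d is an alternating word in s, s*, for which phi(T_d a_1) is
   computed by splitting the word in the middle.

   Multiplication by T_s then gives a recursion for the coefficients along left multiplication in W,
   from which integrality and pi (a Demazure type action of W on twisted involutions) are read off.
   Injectivity follows because the leading terms form the graph of a surjection and u is infinite. *)
theory Submission
  imports Defs
begin

section \<open>Coxeter groups: deletion, exchange and parabolic cosets\<close>

text \<open>M is given by a basis and formulas, so the annihilator of a_1 is not visible and sending
  h a_1 to h X is not evidently well defined. A formula on all of M avoids the question: for
  H-linear mu, the T_1-coefficient of T_(x^-1) mu(v) is u^(2 l(x)) times the T_x-coefficient of
  mu(v), so mu is determined by the functional v -> mu(v)_1. The passage to J is needed because s x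
  is in general not fixed by the automorphism, whereas the shortest element of the coset is. The
  alternating word is split because T_c sends a basis vector to a single basis vector only as long
  as the twisted involutions produced, which are twice as long as the part of the word used so far,
  do not outgrow the whole word. The other half is transposed and applied to the functional; in odd
  length one diagonal entry u is left over. After scaling by u^-2 the entries of T_s on M tend to 0
  at ascents and to 1 at descents as u^-1 goes to 0. In this limit a Kronecker delta in w is carried
  to a Kronecker delta.\<close>

context coxeter_system
begin

declare in_listsD [rule del] in_listsI [rule del]

section \<open>Generators, words and reduced words\<close>

abbreviation len :: "'a \<Rightarrow> nat" where "len \<equiv> cox_length W S"

definition reduced :: "'a list \<Rightarrow> bool" where
  "reduced ws \<longleftrightarrow> ws \<in> lists S \<and> len (word_prod W ws) = length ws"

definition conjg :: "'a \<Rightarrow> 'a \<Rightarrow> 'a" where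
  "conjg g r = g \<otimes> r \<otimes> inv g"

text \<open>For a word x1 ... xn this is the sequence of left reflections x1 ... x(i-1) xi x(i-1)
  ... x1. Multiplying the product of the word on the left by the i-th of them deletes the letter
  xi.\<close>

primrec refls :: "'a list \<Rightarrow> 'a list" where
  "refls [] = []"
| "refls (x # xs) = x # map (conjg x) (refls xs)"

lemma S_carrier [simp]: "s \<in> S \<Longrightarrow> s \<in> carrier W"
  using S_subset by blast

lemma S_square [simp]: "s \<in> S \<Longrightarrow> s \<otimes> s = \<one>"
  using pow_ord_eq_1[of s] ord_S[of s] by (simp add: numeral_2_eq_2)

lemma S_inv [simp]: "s \<in> S \<Longrightarrow> inv s = s"
  using inv_equality[of s s] by simp

lemma S_cancel [simp]: "s \<in> S \<Longrightarrow> w \<in> carrier W \<Longrightarrow> s \<otimes> (s \<otimes> w) = w"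
  by (simp flip: m_assoc)

lemma S_cancel_right [simp]: "s \<in> S \<Longrightarrow> w \<in> carrier W \<Longrightarrow> w \<otimes> s \<otimes> s = w"
  by (simp add: m_assoc)

lemma S_left_eq_iff: "s \<in> S \<Longrightarrow> v \<in> carrier W \<Longrightarrow> w \<in> carrier W \<Longrightarrow> s \<otimes> v = w \<longleftrightarrow> v = s \<otimes> w"
  by auto

lemma word_prod_Nil [simp]: "word_prod W [] = \<one>"
  by (simp add: word_prod_def)

lemma word_prod_Cons [simp]: "word_prod W (x # xs) = x \<otimes> word_prod W xs"
  by (simp add: word_prod_def)

lemma word_prod_closed [simp]: "ws \<in> lists S \<Longrightarrow> word_prod W ws \<in> carrier W"
  by (induction ws) auto

lemma word_prod_append:
  "xs \<in> lists S \<Longrightarrow> ys \<in> lists S \<Longrightarrow> word_prod W (xs @ ys) = word_prod W xs \<otimes> word_prod W ys"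
  by (induction xs) (auto simp: m_assoc)

lemma rev_lists [simp]: "rev ws \<in> lists A \<longleftrightarrow> ws \<in> lists A"
  by (simp add: in_lists_conv_set)

lemma word_prod_rev: "ws \<in> lists S \<Longrightarrow> word_prod W (rev ws) = inv (word_prod W ws)"
  by (induction ws) (simp_all add: word_prod_append inv_mult_group)

lemma exists_word: "w \<in> carrier W \<Longrightarrow> \<exists>ws\<in>lists S. word_prod W ws = w"
  unfolding generate_S[symmetric]
proof (induction rule: generate.induct)
  case one
  show ?case by (rule bexI[of _ "[]"]) auto
next
  case (incl h)
  then show ?case by (intro bexI[of _ "[h]"]) auto
next
  case (inv h)
  then show ?case by (intro bexI[of _ "[h]"]) auto
next
  case (eng h1 h2)
  then obtain xs ys where "xs \<in> lists S" "ys \<in> lists S" "word_prod W xs = h1" "word_prod W ys = h2"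
    by blast
  then show ?case by (intro bexI[of _ "xs @ ys"]) (auto simp: word_prod_append)
qed

lemma reduced_lists: "reduced ws \<Longrightarrow> ws \<in> lists S"
  by (simp add: reduced_def)

lemma exists_reduced:
  assumes "w \<in> carrier W"
  obtains ws where "reduced ws" "word_prod W ws = w" "length ws = len w"
proof -
  have "\<exists>n. \<exists>ws\<in>lists S. length ws = n \<and> word_prod W ws = w"
    using exists_word[OF assms] by blast
  from LeastI_ex[OF this] that show ?thesis
    unfolding reduced_def cox_length_def by metis
qed

lemma len_word_le: "ws \<in> lists S \<Longrightarrow> len (word_prod W ws) \<le> length ws"
  unfolding cox_length_def by (rule Least_le) blast

lemma len_one [simp]: "len \<one> = 0"
  using len_word_le[of "[]"] by simp

lemma len_eq_0: "w \<in> carrier W \<Longrightarrow> len w = 0 \<longleftrightarrow> w = \<one>"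
  by (metis exists_reduced len_one length_0_conv word_prod_Nil)

section \<open>Reflections attached to a word; deletion and exchange\<close>

lemma conjg_closed [simp]: "g \<in> carrier W \<Longrightarrow> r \<in> carrier W \<Longrightarrow> conjg g r \<in> carrier W"
  by (simp add: conjg_def)

lemma conjg_one [simp]: "r \<in> carrier W \<Longrightarrow> conjg \<one> r = r"
  by (simp add: conjg_def)

lemma conjg_mult:
  "g \<in> carrier W \<Longrightarrow> h \<in> carrier W \<Longrightarrow> r \<in> carrier W \<Longrightarrow> conjg g (conjg h r) = conjg (g \<otimes> h) r"
  by (simp add: conjg_def inv_mult_group m_assoc)

lemma conjg_inj: "g \<in> carrier W \<Longrightarrow> inj_on (conjg g) (carrier W)"
  by (auto simp: inj_on_def conjg_def)

lemma refls_closed: "ws \<in> lists S \<Longrightarrow> set (refls ws) \<subseteq> carrier W"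
  by (induction ws) auto

lemma length_refls [simp]: "length (refls ws) = length ws"
  by (induction ws) auto

lemma refls_append:
  "xs \<in> lists S \<Longrightarrow> ys \<in> lists S \<Longrightarrow>
    refls (xs @ ys) = refls xs @ map (conjg (word_prod W xs)) (refls ys)"
proof (induction xs)
  case Nil
  have "map (conjg \<one>) (refls ys) = refls ys"
    using refls_closed[OF Nil(2)] by (intro map_idI) auto
  then show ?case by simp
next
  case (Cons x xs)
  have "conjg x (conjg (word_prod W xs) r) = conjg (x \<otimes> word_prod W xs) r" if "r \<in> set (refls ys)" for r
    using Cons.prems that refls_closed[of ys] by (intro conjg_mult) auto
  then show ?case using Cons by simp
qed

text \<open>Conjugation by s t adds two to the exponent in (s t)^i s. If (s t)^n = 1, the 2 n
  entries therefore run twice through the same n reflections.\<close>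

lemma refls_alternating:
  assumes s: "s \<in> S" and t: "t \<in> S"
  shows "refls (concat (replicate n [s, t])) = map (\<lambda>i. (s \<otimes> t) [^] i \<otimes> s) [0..<2 * n]"
proof (induction n)
  case (Suc n)
  have conj: "conjg s (conjg t ((s \<otimes> t) [^] i \<otimes> s)) = (s \<otimes> t) [^] (Suc (Suc i)) \<otimes> s" for i :: nat
  proof -
    have "conjg s (conjg t ((s \<otimes> t) [^] i \<otimes> s)) = (s \<otimes> t) \<otimes> (s \<otimes> t) [^] i \<otimes> (s \<otimes> t) \<otimes> s"
      using s t by (simp add: conjg_def m_assoc)
    also have "(s \<otimes> t) \<otimes> (s \<otimes> t) [^] i = (s \<otimes> t) [^] Suc i"
      using s t by (intro nat_pow_Suc2[symmetric]) auto
    finally show ?thesis using s t by simp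
  qed
  have "[0..<2 * Suc n] = 0 # 1 # map (\<lambda>i. Suc (Suc i)) [0..<2 * n]"
    using map_add_upt[of 2 "2 * n"] by (simp add: upt_conv_Cons numeral_2_eq_2 del: upt_Suc)
  then show ?case using s t Suc conj
    by (simp add: o_def conjg_def[of s t])
qed simp

lemma word_prod_alternating:
  assumes "s \<in> S" "t \<in> S"
  shows "word_prod W (concat (replicate n [s, t])) = (s \<otimes> t) [^] n"
proof (induction n)
  case (Suc n)
  have "word_prod W (concat (replicate (Suc n) [s, t])) = (s \<otimes> t) \<otimes> (s \<otimes> t) [^] n"
    using Suc assms by (simp add: m_assoc)
  also have "\<dots> = (s \<otimes> t) [^] Suc n"
    using assms by (intro nat_pow_Suc2[symmetric]) auto
  finally show ?case .
qed simp

lemma alternating_lists: "s \<in> S \<Longrightarrow> t \<in> S \<Longrightarrow> concat (replicate n [s, t]) \<in> lists S"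
  by (induction n) auto

text \<open>The reflections of the relator \<open>(s t)\<^sup>m\<close> form a list \<open>L @ L\<close>, so the parity of the number of
  occurrences of a reflection is an invariant of the element represented by a word.\<close>

lemma coxeter_cong_refl_parity:
  "coxeter_cong W S xs ys \<Longrightarrow> even (count_list (refls xs) r) \<longleftrightarrow> even (count_list (refls ys) r)"
proof (induction rule: coxeter_cong.induct)
  case (rel s t xs ys)
  define n where "n = ord (s \<otimes> t)"
  define mid where "mid = concat (replicate n [s, t])"
  have mid: "mid \<in> lists S" using rel alternating_lists by (simp add: mid_def)
  have pow: "(s \<otimes> t) [^] n = \<one>" using rel by (simp add: n_def)
  have wp: "word_prod W mid = \<one>" using word_prod_alternating rel pow by (simp add: mid_def)
  have "[0..<2 * n] = [0..<n] @ map (\<lambda>i. i + n) [0..<n]"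
    using upt_add_eq_append[of 0 n n] map_add_upt[of n n] by (simp add: mult_2)
  moreover have "(s \<otimes> t) [^] (i + n) = (s \<otimes> t) [^] i" for i :: nat
    using rel pow by (simp flip: nat_pow_mult)
  ultimately obtain L where L: "refls mid = L @ L"
    using refls_alternating[of s t n] rel by (simp add: mid_def o_def)
  have "map (conjg \<one>) (refls ys) = refls ys"
    using refls_closed[of ys] rel by (intro map_idI) auto
  then have "refls (xs @ mid @ ys) = refls xs @ map (conjg (word_prod W xs)) (L @ L @ refls ys)"
    using rel mid wp L by (simp add: refls_append)
  then have "count_list (refls (xs @ mid @ ys)) r = 
     2 * count_list (map (conjg (word_prod W xs)) L) r + count_list (refls (xs @ ys)) r"
    using rel by (simp add: refls_append)
  then show ?case by (simp add: mid_def n_def)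
qed auto

text \<open>Each relator (s t)^m consists of 2 m letters. This is what excludes l(s w) =
  l(w).\<close>

lemma coxeter_cong_length_parity:
  "coxeter_cong W S xs ys \<Longrightarrow> even (length xs) \<longleftrightarrow> even (length ys)"
proof (induction rule: coxeter_cong.induct)
  case (rel s t xs ys)
  have "length (concat (replicate n [s, t])) = 2 * n" for n by (induction n) auto
  then show ?case by simp
qed auto

lemma count_list_distinct: "distinct xs \<Longrightarrow> x \<in> set xs \<Longrightarrow> count_list xs x = 1"
  by (induction xs) auto

text \<open>A reflection listed exactly once has odd count, and the parity is the same in all words
  for the element. So it also appears for a shortest word, which then has at least as many letters
  as \<open>ws\<close>.\<close>

lemma reduced_if_distinct_refls:
  assumes ws: "ws \<in> lists S" and d: "distinct (refls ws)"
  shows "reduced ws"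
proof -
  obtain vs where vs: "reduced vs" "word_prod W vs = word_prod W ws" "length vs = len (word_prod W ws)"
    using exists_reduced[OF word_prod_closed[OF ws]] .
  have par: "even (count_list (refls ws) r) \<longleftrightarrow> even (count_list (refls vs) r)" for r
    using presentation[OF ws reduced_lists[OF vs(1)]] vs(2) coxeter_cong_refl_parity by metis
  have "set (refls ws) \<subseteq> set (refls vs)"
  proof
    fix r assume "r \<in> set (refls ws)"
    then have "count_list (refls ws) r = 1" using d count_list_distinct by fast
    then have "odd (count_list (refls vs) r)" using par by (metis odd_one)
    then show "r \<in> set (refls vs)" by (metis count_notin even_zero)
  qed
  then have "card (set (refls ws)) \<le> length vs"
    by (metis List.finite_set card_length card_mono le_trans length_refls)
  then have "length ws \<le> length vs" using distinct_card[OF d] by simp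
  then show ?thesis using len_word_le[OF ws] vs ws by (simp add: reduced_def)
qed

lemma refl_deletes_letter:
  "ws \<in> lists S \<Longrightarrow> r \<in> set (refls ws) \<Longrightarrow>
    \<exists>ys b zs. ws = ys @ b # zs \<and> r \<otimes> word_prod W ws = word_prod W (ys @ zs)"
proof (induction ws arbitrary: r)
  case (Cons x ws)
  then have x: "x \<in> S" and ws: "ws \<in> lists S" by auto
  show ?case
  proof (cases "r = x")
    case True
    with x ws have "x # ws = [] @ x # ws \<and> r \<otimes> word_prod W (x # ws) = word_prod W ([] @ ws)" by simp
    then show ?thesis by blast
  next
    case False
    then obtain r' where r': "r' \<in> set (refls ws)" "r = conjg x r'" using Cons.prems by auto
    from Cons.IH[OF ws r'(1)] obtain ys b zs where
      y: "ws = ys @ b # zs" "r' \<otimes> word_prod W ws = word_prod W (ys @ zs)" by blast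
    have "r' \<in> carrier W" using r' refls_closed ws by blast
    then have "r \<otimes> word_prod W (x # ws) = x \<otimes> (r' \<otimes> word_prod W ws)"
      using r'(2) x ws by (simp add: conjg_def m_assoc)
    then have "x # ws = (x # ys) @ b # zs \<and> r \<otimes> word_prod W (x # ws) = word_prod W ((x # ys) @ zs)"
      using y by simp
    then show ?thesis by blast
  qed
qed simp

text \<open>Multiplying twice by a repeated reflection changes nothing, but it can be read as
  deleting two different letters. The repetition lies in the tail, or it involves the first
  letter.\<close>

lemma deletion_refls:
  "ws \<in> lists S \<Longrightarrow> \<not> distinct (refls ws) \<Longrightarrow>
    \<exists>xs a ys b zs. ws = xs @ a # ys @ b # zs \<and> word_prod W ws = word_prod W (xs @ ys @ zs)"
proof (induction ws)
  case (Cons x ws)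
  then have x: "x \<in> S" and ws: "ws \<in> lists S" by auto
  note cl = refls_closed[OF ws]
  show ?case
  proof (cases "distinct (refls ws)")
    case True
    then have "distinct (map (conjg x) (refls ws))"
      using conjg_inj[of x] x cl by (auto simp: distinct_map intro: inj_on_subset)
    then have "x \<in> conjg x ` set (refls ws)" using Cons.prems by simp
    then obtain r where r: "r \<in> set (refls ws)" "x = x \<otimes> r \<otimes> x" using x by (auto simp: conjg_def)
    have "conjg x x = x" using x by (simp add: conjg_def)
    then have "r = x" using inj_onD[OF conjg_inj[of x], of r x] r x cl by (auto simp: conjg_def)
    then obtain ys b zs where "ws = ys @ b # zs" "x \<otimes> word_prod W ws = word_prod W (ys @ zs)"
      using refl_deletes_letter[OF ws r(1)] by auto
    then have "x # ws = [] @ x # ys @ b # zs \<and> word_prod W (x # ws) = word_prod W ([] @ ys @ zs)" by simp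
    then show ?thesis by blast
  next
    case False
    from Cons.IH[OF ws False] obtain xs a ys b zs where
      "ws = xs @ a # ys @ b # zs" "word_prod W ws = word_prod W (xs @ ys @ zs)" by blast
    then have "x # ws = (x # xs) @ a # ys @ b # zs \<and>
        word_prod W (x # ws) = word_prod W ((x # xs) @ ys @ zs)" by simp
    then show ?thesis by blast
  qed
qed simp

lemma deletion:
  assumes "ws \<in> lists S" "\<not> reduced ws"
  obtains xs a ys b zs where "ws = xs @ a # ys @ b # zs" "word_prod W ws = word_prod W (xs @ ys @ zs)"
  using deletion_refls[of ws] reduced_if_distinct_refls[of ws] assms by blast

lemma reduced_tl: "reduced (s # ws) \<Longrightarrow> reduced ws"
proof -
  assume r: "reduced (s # ws)"
  then have s: "s \<in> S" and ws: "ws \<in> lists S" by (auto simp: reduced_def)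
  obtain vs where vs: "reduced vs" "word_prod W vs = word_prod W ws" "length vs = len (word_prod W ws)"
    using exists_reduced[OF word_prod_closed[OF ws]] .
  have "len (word_prod W (s # vs)) \<le> length (s # vs)"
    using s reduced_lists[OF vs(1)] by (intro len_word_le) auto
  then show ?thesis using r vs len_word_le[OF ws] ws by (simp add: reduced_def)
qed

text \<open>Deletion removes two letters of \<open>s # ws\<close>. If \<open>s\<close> were not
  among them it could be cancelled, and the reduced word \<open>ws\<close> would have a shorter
  representative.\<close>

lemma exchange:
  assumes "s \<in> S" "reduced ws" "\<not> reduced (s # ws)"
  obtains ys b zs where "ws = ys @ b # zs" "s \<otimes> word_prod W ws = word_prod W (ys @ zs)"
proof -
  have ws: "ws \<in> lists S" using assms reduced_lists by blast
  obtain xs a ys b zs where d: "s # ws = xs @ a # ys @ b # zs"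
    "word_prod W (s # ws) = word_prod W (xs @ ys @ zs)"
    using deletion[of "s # ws"] assms ws by (metis Cons_in_lists_iff)
  show ?thesis
  proof (cases xs)
    case Nil
    then show ?thesis using d that by simp
  next
    case (Cons x xs')
    then have e: "ws = xs' @ a # ys @ b # zs" "x = s" using d by auto
    then have "xs' @ ys @ zs \<in> lists S" using ws by auto
    then have "word_prod W ws = word_prod W (xs' @ ys @ zs)" "len (word_prod W (xs' @ ys @ zs)) < length ws"
      using d Cons e ws assms(1) len_word_le[of "xs' @ ys @ zs"] by auto
    then show ?thesis using assms(2) by (simp add: reduced_def)
  qed
qed

section \<open>Length under inversion and multiplication by a generator\<close>

lemma len_parity: "ws \<in> lists S \<Longrightarrow> even (len (word_prod W ws)) \<longleftrightarrow> even (length ws)"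
proof -
  assume ws: "ws \<in> lists S"
  obtain vs where vs: "reduced vs" "word_prod W vs = word_prod W ws" "length vs = len (word_prod W ws)"
    using exists_reduced[OF word_prod_closed[OF ws]] .
  then have "coxeter_cong W S vs ws" using presentation reduced_lists ws by blast
  then show ?thesis using coxeter_cong_length_parity vs(3) by metis
qed

lemma len_inv [simp]: "w \<in> carrier W \<Longrightarrow> len (inv w) = len w"
proof -
  have le: "len (inv w) \<le> len w" if w: "w \<in> carrier W" for w
  proof -
    obtain ws where ws: "reduced ws" "word_prod W ws = w" "length ws = len w"
      using exists_reduced[OF w] .
    then show ?thesis
      using len_word_le[of "rev ws"] word_prod_rev[of ws] reduced_lists[of ws] by simp
  qed
  assume "w \<in> carrier W"
  then show ?thesis using le[of w] le[of "inv w"] by simp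
qed

lemma len_mult_le: "v \<in> carrier W \<Longrightarrow> w \<in> carrier W \<Longrightarrow> len (v \<otimes> w) \<le> len v + len w"
proof -
  assume v: "v \<in> carrier W" and w: "w \<in> carrier W"
  obtain vs where vs: "reduced vs" "word_prod W vs = v" "length vs = len v" using exists_reduced[OF v] .
  obtain ws where ws: "reduced ws" "word_prod W ws = w" "length ws = len w" using exists_reduced[OF w] .
  show ?thesis using len_word_le[of "vs @ ws"] vs ws word_prod_append[of vs ws]
    by (simp add: reduced_def)
qed

lemma len_S [simp]: "s \<in> S \<Longrightarrow> len s = 1"
proof -
  assume s: "s \<in> S"
  have "len s \<le> 1" "s \<noteq> \<one>" using len_word_le[of "[s]"] s ord_S[OF s] ord_eq_1[of s] by auto
  then show "len s = 1" using len_eq_0[of s] s by (simp add: le_Suc_eq)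
qed

lemma len_left_cases:
  assumes "s \<in> S" "w \<in> carrier W"
  shows "len (s \<otimes> w) = Suc (len w) \<or> len w = Suc (len (s \<otimes> w))"
proof -
  obtain ws where ws: "reduced ws" "word_prod W ws = w" "length ws = len w"
    using exists_reduced[OF assms(2)] .
  have "even (len (s \<otimes> w)) \<longleftrightarrow> \<not> even (len w)"
    using len_parity[of "s # ws"] ws assms by (simp add: reduced_def)
  moreover have "len (s \<otimes> w) \<le> Suc (len w)" using len_mult_le[of s w] assms by simp
  moreover have "len w \<le> Suc (len (s \<otimes> w))" using len_mult_le[of s "s \<otimes> w"] assms by simp
  ultimately show ?thesis by (metis le_SucE le_antisym not_less_eq_eq)
qed

lemma len_right: "s \<in> S \<Longrightarrow> w \<in> carrier W \<Longrightarrow> len (w \<otimes> s) = len (s \<otimes> inv w)"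
  using len_inv[of "w \<otimes> s"] by (simp add: inv_mult_group)

lemma len_right_cases:
  assumes "s \<in> S" "w \<in> carrier W"
  shows "len (w \<otimes> s) = Suc (len w) \<or> len w = Suc (len (w \<otimes> s))"
  using len_left_cases[of s "inv w"] len_right[of s w] assms by simp

lemma exists_left_descent:
  assumes "w \<in> carrier W" "w \<noteq> \<one>"
  obtains s where "s \<in> S" "len w = Suc (len (s \<otimes> w))"
proof -
  obtain ws where ws: "reduced ws" "word_prod W ws = w" "length ws = len w"
    using exists_reduced[OF assms(1)] .
  then obtain s vs where e: "ws = s # vs" using assms by (cases ws) auto
  then have "s \<in> S" "vs \<in> lists S" "reduced vs" using ws reduced_tl[of s vs] by (auto simp: reduced_def)
  moreover have "s \<otimes> w = word_prod W vs" using calculation ws e by auto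
  ultimately show ?thesis using that[of s] ws e by (simp add: reduced_def)
qed

text \<open>Exchange applies to \<open>s\<close> and the word of v t. Deleting a letter inside v
  would make s v shorter than v, so the deleted letter is the final t, that is, s v t = v.\<close>

lemma left_right_ascent_fold:
  assumes s: "s \<in> S" and t: "t \<in> S" and v: "v \<in> carrier W"
    and l: "len (s \<otimes> v) = Suc (len v)" and r: "len (v \<otimes> t) = Suc (len v)"
    and f: "len (s \<otimes> v \<otimes> t) \<noteq> Suc (Suc (len v))"
  shows "s \<otimes> v = v \<otimes> t"
proof -
  obtain vs where vs: "reduced vs" "word_prod W vs = v" "length vs = len v" using exists_reduced[OF v] .
  have vsl: "vs \<in> lists S" using vs reduced_lists by blast
  have red: "reduced (vs @ [t])" using vs vsl t r by (simp add: reduced_def word_prod_append)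
  have nred: "\<not> reduced (s # vs @ [t])"
    using f vs vsl s t v by (auto simp: reduced_def word_prod_append m_assoc)
  obtain ys b zs where e: "vs @ [t] = ys @ b # zs" "s \<otimes> word_prod W (vs @ [t]) = word_prod W (ys @ zs)"
    using exchange[OF s red nred] .
  have lists: "vs @ [t] \<in> lists S" using red reduced_lists by blast
  show ?thesis
  proof (cases zs rule: rev_cases)
    case Nil
    then have "s \<otimes> (v \<otimes> t) = v" using e vs vsl t by (simp add: word_prod_append)
    then show ?thesis using s v t by (metis S_cancel S_carrier m_closed)
  next
    case (snoc zs' c)
    then have e': "vs = ys @ b # zs'" "c = t" using e by auto
    have m: "ys @ zs' \<in> lists S" using vsl e' by auto
    have "word_prod W (vs @ [t]) = v \<otimes> t" using vs(2) vsl t by (simp add: word_prod_append)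
    then have "s \<otimes> v \<otimes> t = word_prod W (ys @ zs) " using e(2) s v t by (simp add: m_assoc)
    also have "\<dots> = word_prod W (ys @ zs') \<otimes> t"
      using snoc e'(2) t m word_prod_append[of "ys @ zs'" "[t]"] by simp
    finally have "s \<otimes> v \<otimes> t = word_prod W (ys @ zs') \<otimes> t" .
    then have "s \<otimes> v = word_prod W (ys @ zs')" using s t v m by simp
    then have "len (s \<otimes> v) \<le> length (ys @ zs')" using len_word_le[OF m] by simp
    then show ?thesis using l vs e' by simp
  qed
qed

section \<open>Parabolic subgroups and minimal coset representatives\<close>

lemma exists_reduced_subword:
  "ws \<in> lists S \<Longrightarrow> \<exists>vs. reduced vs \<and> word_prod W vs = word_prod W ws \<and> set vs \<subseteq> set ws"
proof (induction ws rule: length_induct)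
  case (1 ws)
  show ?case
  proof (cases "reduced ws")
    case False
    obtain xs a ys b zs where d: "ws = xs @ a # ys @ b # zs" "word_prod W ws = word_prod W (xs @ ys @ zs)"
      using deletion[OF 1(2) False] .
    have "\<exists>vs. reduced vs \<and> word_prod W vs = word_prod W (xs @ ys @ zs) \<and> set vs \<subseteq> set (xs @ ys @ zs)"
      using 1 d by (intro 1(1)[rule_format]) auto
    then show ?thesis using d by auto
  qed blast
qed

definition parabolic :: "'a set \<Rightarrow> 'a set" where
  "parabolic J = word_prod W ` lists J"

lemma lists_subset: "J \<subseteq> S \<Longrightarrow> ws \<in> lists J \<Longrightarrow> ws \<in> lists S"
  using lists_mono by blast

lemma parabolic_carrier: "J \<subseteq> S \<Longrightarrow> w \<in> parabolic J \<Longrightarrow> w \<in> carrier W"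
  using lists_subset by (auto simp: parabolic_def)

lemma parabolic_one [simp]: "\<one> \<in> parabolic J"
  unfolding parabolic_def by (rule image_eqI[of _ _ "[]"]) auto

lemma parabolic_mult:
  "J \<subseteq> S \<Longrightarrow> v \<in> parabolic J \<Longrightarrow> w \<in> parabolic J \<Longrightarrow> v \<otimes> w \<in> parabolic J"
  unfolding parabolic_def using lists_subset word_prod_append
  by (smt (verit, best) append_in_lists_conv image_iff)

lemma parabolic_inv:
  "J \<subseteq> S \<Longrightarrow> w \<in> parabolic J \<Longrightarrow> inv w \<in> parabolic J"
proof -
  assume J: "J \<subseteq> S" and "w \<in> parabolic J"
  then obtain ws where "ws \<in> lists J" "w = word_prod W ws" by (auto simp: parabolic_def)
  then have "rev ws \<in> lists J" "inv w = word_prod W (rev ws)"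
    using word_prod_rev lists_subset[OF J] by auto
  then show ?thesis by (auto simp: parabolic_def)
qed

lemma parabolic_gen: "J \<subseteq> S \<Longrightarrow> s \<in> J \<Longrightarrow> s \<in> parabolic J"
  unfolding parabolic_def by (rule image_eqI[of _ _ "[s]"]) auto

lemma parabolic_reduced:
  assumes "J \<subseteq> S" "w \<in> parabolic J"
  obtains ws where "ws \<in> lists J" "reduced ws" "word_prod W ws = w"
proof -
  obtain vs where vs: "vs \<in> lists J" "w = word_prod W vs" using assms by (auto simp: parabolic_def)
  then obtain ws where "reduced ws" "word_prod W ws = word_prod W vs" "set ws \<subseteq> set vs"
    using exists_reduced_subword[of vs] lists_subset[OF assms(1)] by blast
  then show ?thesis using that[of ws] vs by (auto simp: in_lists_conv_set)
qed

text \<open>If a further letter s did not lengthen w y, exchange would delete a letter. Inside w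
  this contradicts that the word of s w is reduced; inside y it yields w^-1 s w y, a shorter element
  of the same coset.\<close>

lemma len_minimal_coset:
  assumes J: "J \<subseteq> S" and y: "y \<in> carrier W"
    and min: "\<And>w. w \<in> parabolic J \<Longrightarrow> len y \<le> len (w \<otimes> y)"
    and w: "w \<in> parabolic J"
  shows "len (w \<otimes> y) = len w + len y"
proof -
  obtain ys where ys: "reduced ys" "word_prod W ys = y" "length ys = len y" using exists_reduced[OF y] .
  have ysl: "ys \<in> lists S" using ys reduced_lists by blast
  have red: "reduced (ws @ ys)" if "ws \<in> lists J" "reduced ws" for ws
    using that
  proof (induction ws rule: list.induct)
    case (Cons s ws)
    have s: "s \<in> J" "s \<in> S" and ws: "ws \<in> lists J" "ws \<in> lists S"
      using Cons.prems J lists_subset by auto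
    have r: "reduced ws" using Cons.prems(2) by (rule reduced_tl)
    have IH: "reduced (ws @ ys)" using Cons.IH[OF ws(1) r] .
    define w where "w = word_prod W ws"
    have wc: "w \<in> carrier W" "w \<in> parabolic J" using ws by (auto simp: w_def parabolic_def)
    show ?case
    proof (rule ccontr)
      assume "\<not> reduced ((s # ws) @ ys)"
      then have "\<not> reduced (s # ws @ ys)" by simp
      from exchange[OF s(2) IH this] obtain us b zs where
        e: "ws @ ys = us @ b # zs" "s \<otimes> word_prod W (ws @ ys) = word_prod W (us @ zs)" .
      have usl: "us \<in> lists S" "zs \<in> lists S"
        using ws ysl e(1) by (metis append_in_lists_conv Cons_in_lists_iff)+
      consider (ws) zs' where "ws = us @ b # zs'" "zs = zs' @ ys" | (ys) us' where "us = ws @ us'" "ys = us' @ b # zs"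
        using e(1) by (auto simp: append_eq_append_conv2 append_eq_Cons_conv)
      then show False
      proof cases
        case ws
        have z: "us @ zs' \<in> lists S" using ws \<open>ws \<in> lists S\<close> by auto
        have "s \<otimes> w \<otimes> y = word_prod W (us @ zs') \<otimes> y"
          using e(2) ws \<open>ws \<in> lists S\<close> ysl ys s y wc z word_prod_append[of "us @ zs'" ys]
          by (simp add: w_def word_prod_append m_assoc)
        then have "s \<otimes> w = word_prod W (us @ zs')" using s wc y z by simp
        then have "len (s \<otimes> w) \<le> length (us @ zs')" using len_word_le[OF z] by simp
        then show False using Cons.prems(2) ws by (simp add: reduced_def w_def)
      next
        case ys
        have z: "us' @ zs \<in> lists S" "us' \<in> lists S" using ys ysl by auto
        define y' where "y' = word_prod W (us' @ zs)"
        have y': "y' \<in> carrier W" using z by (simp add: y'_def)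
        have "s \<otimes> (w \<otimes> y) = w \<otimes> y'"
          using e(2) ys \<open>ws \<in> lists S\<close> ysl \<open>word_prod W ys = y\<close> z word_prod_append[of ws "us' @ zs"]
          by (simp add: w_def word_prod_append y'_def)
        then have "y' = inv w \<otimes> s \<otimes> w \<otimes> y" using s wc y y'
          by (simp add: m_assoc inv_solve_left)
        moreover have "inv w \<otimes> s \<otimes> w \<in> parabolic J"
          using wc s J parabolic_inv parabolic_mult parabolic_gen by meson
        ultimately have "len y \<le> len y'" using min by simp
        moreover have "len y' \<le> length (us' @ zs)" using len_word_le[OF z(1)] by (simp add: y'_def)
        ultimately show False using ys \<open>length ys = len y\<close> by simp
      qed
    qed
  qed (use ys in simp)
  obtain ws where "ws \<in> lists J" "reduced ws" "word_prod W ws = w" using parabolic_reduced[OF J w] .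
  then show ?thesis using red[of ws] ys ysl by (auto simp: reduced_def word_prod_append)
qed

end


section \<open>Twisted involutions\<close>

locale twisted_coxeter = coxeter_system W S for W (structure) and S +
  fixes star :: "'a \<Rightarrow> 'a"
  assumes star_iso: "star \<in> iso W W"
    and star_S: "star ` S = S"
    and star_star: "w \<in> carrier W \<Longrightarrow> star (star w) = w"
begin

section \<open>Twisted conjugation, ascents and descents\<close>

abbreviation I :: "'a set" where "I \<equiv> twisted_involutions W star"

text \<open>The first case is the one in which the twisted conjugate s w (star s) would be w itself;
  there s w takes its place. In this way \<open>tconj s\<close> is an involution of \<open>I\<close>
  without fixed points, and it covers all four formulas for the action of T_s.\<close>

definition tconj :: "'a \<Rightarrow> 'a \<Rightarrow> 'a" where
  "tconj s w = (if s \<otimes> w = w \<otimes> star s then s \<otimes> w else s \<otimes> w \<otimes> star s)"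

abbreviation asc :: "'a \<Rightarrow> 'a \<Rightarrow> bool" where
  "asc s w \<equiv> len w < len (s \<otimes> w)"

lemma star_closed [simp]: "w \<in> carrier W \<Longrightarrow> star w \<in> carrier W"
  using star_iso by (auto simp: iso_def hom_def)

lemma star_mult [simp]:
  "v \<in> carrier W \<Longrightarrow> w \<in> carrier W \<Longrightarrow> star (v \<otimes> w) = star v \<otimes> star w"
  using star_iso by (auto simp: iso_def hom_def)

lemma star_one [simp]: "star \<one> = \<one>"
proof -
  have "star \<one> \<otimes> star \<one> = star \<one>" by (metis one_closed star_mult l_one)
  then show ?thesis using l_cancel_one[of "star \<one>" "star \<one>"] by simp
qed

lemma star_inv [simp]: "w \<in> carrier W \<Longrightarrow> star (inv w) = inv (star w)"
  using inv_equality[of "star (inv w)" "star w"] star_mult[of "inv w" w] by simp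

lemma star_in_S [simp]: "s \<in> S \<Longrightarrow> star s \<in> S"
  using star_S by blast

lemma star_funpow_in_S: "s \<in> S \<Longrightarrow> (star ^^ n) s \<in> S"
  by (induction n) auto

lemma map_star_lists: "ws \<in> lists S \<Longrightarrow> map star ws \<in> lists S"
  by (induction ws) auto

lemma word_prod_map_star: "ws \<in> lists S \<Longrightarrow> word_prod W (map star ws) = star (word_prod W ws)"
  by (induction ws) auto

lemma len_star [simp]: "w \<in> carrier W \<Longrightarrow> len (star w) = len w"
proof -
  have le: "len (star w) \<le> len w" if w: "w \<in> carrier W" for w
  proof -
    obtain ws where ws: "reduced ws" "word_prod W ws = w" "length ws = len w"
      using exists_reduced[OF w] .
    then show ?thesis
      using len_word_le[of "map star ws"] word_prod_map_star[of ws] reduced_lists[of ws] map_star_lists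
      by simp
  qed
  assume "w \<in> carrier W"
  then show ?thesis using le[of w] le[of "star w"] by (simp add: star_star)
qed

lemma I_carrier: "w \<in> I \<Longrightarrow> w \<in> carrier W"
  by (simp add: twisted_involutions_def)

lemma I_star: "w \<in> I \<Longrightarrow> star w = inv w"
  by (simp add: twisted_involutions_def)

lemma I_I: "w \<in> carrier W \<Longrightarrow> star w = inv w \<Longrightarrow> w \<in> I"
  by (simp add: twisted_involutions_def)

lemma one_in_I [simp]: "\<one> \<in> I"
  by (simp add: twisted_involutions_def)

declare I_carrier [simp]

lemma asc_iff: "s \<in> S \<Longrightarrow> w \<in> carrier W \<Longrightarrow> asc s w \<longleftrightarrow> len (s \<otimes> w) = Suc (len w)"
  using len_left_cases[of s w] by auto

lemma not_asc_iff: "s \<in> S \<Longrightarrow> w \<in> carrier W \<Longrightarrow> \<not> asc s w \<longleftrightarrow> len w = Suc (len (s \<otimes> w))"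
  using len_left_cases[of s w] by auto

lemma asc_mult: "s \<in> S \<Longrightarrow> w \<in> carrier W \<Longrightarrow> asc s (s \<otimes> w) \<longleftrightarrow> \<not> asc s w"
  using len_left_cases[of s w] by auto

lemma len_right_star: "s \<in> S \<Longrightarrow> w \<in> I \<Longrightarrow> len (w \<otimes> star s) = len (s \<otimes> w)"
  using len_right[of "star s" w] len_star[of "s \<otimes> w"] by (simp add: I_star)

lemma star_fixed_right: "s \<in> S \<Longrightarrow> w \<in> carrier W \<Longrightarrow> star w = inv w \<Longrightarrow>
  star (w \<otimes> star s) = inv (s \<otimes> w) \<and> star (s \<otimes> w) = inv (w \<otimes> star s)"
  by (simp add: inv_mult_group star_star)

lemma tconj_in_I [simp]:
  assumes s: "s \<in> S" and w: "w \<in> I"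
  shows "tconj s w \<in> I"
proof (cases "s \<otimes> w = w \<otimes> star s")
  case True
  then show ?thesis using s w star_fixed_right[OF s _ I_star[OF w]]
    by (auto simp: tconj_def intro!: I_I)
next
  case False
  then show ?thesis using s w
    by (auto simp: tconj_def inv_mult_group star_star m_assoc I_star intro!: I_I)
qed

lemma tconj_comm_iff:
  assumes s: "s \<in> S" and w: "w \<in> carrier W"
  shows "s \<otimes> tconj s w = tconj s w \<otimes> star s \<longleftrightarrow> s \<otimes> w = w \<otimes> star s"
proof (cases "s \<otimes> w = w \<otimes> star s")
  case True
  then have "tconj s w = w \<otimes> star s" "tconj s w = s \<otimes> w" by (simp_all add: tconj_def)
  then show ?thesis using True s w by (metis S_cancel S_cancel_right star_in_S)
next
  case False
  then show ?thesis using s w by (auto simp: tconj_def m_assoc)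
qed

lemma tconj_tconj [simp]:
  assumes s: "s \<in> S" and w: "w \<in> carrier W"
  shows "tconj s (tconj s w) = w"
proof (cases "s \<otimes> w = w \<otimes> star s")
  case True
  then show ?thesis using s w tconj_comm_iff[OF s w] by (simp add: tconj_def)
next
  case False
  then show ?thesis using s w tconj_comm_iff[OF s w] by (simp add: tconj_def m_assoc)
qed

lemma tconj_closed [simp]: "s \<in> S \<Longrightarrow> w \<in> carrier W \<Longrightarrow> tconj s w \<in> carrier W"
  by (simp add: tconj_def)

text \<open>For a twisted involution s w and w (star s) have equal length, so an ascent on one side
  is an ascent on both. Outside the commuting case the fold lemma then leaves only the length l(w) +
  2.\<close>

lemma tconj_asc_len:
  assumes s: "s \<in> S" and w: "w \<in> I" and a: "asc s w"
  shows "len (s \<otimes> tconj s w) < len (tconj s w) \<and> len w < len (tconj s w)"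
proof (cases "s \<otimes> w = w \<otimes> star s")
  case True
  then have t: "tconj s w = s \<otimes> w" by (simp add: tconj_def)
  have "s \<otimes> (s \<otimes> w) = w" using s w by simp
  then show ?thesis using a t by simp
next
  case False
  have l: "len (s \<otimes> w) = Suc (len w)" using a s w asc_iff by simp
  have "len (s \<otimes> w \<otimes> star s) = Suc (Suc (len w))"
    using left_right_ascent_fold[of s "star s" w] s w l len_right_star[OF s w] False by auto
  then show ?thesis using False s w l len_right_star[OF s w] by (simp add: tconj_def m_assoc)
qed

text \<open>Suppose \<open>s\<close> remained a descent in the noncommuting case. Then v = s w has
  ascents on both sides while s v (star s) is no longer than v, so the fold lemma gives s v = v
  (star s), which is the commuting case.\<close>

lemma tconj_desc_asc:
  assumes s: "s \<in> S" and w: "w \<in> I" and d: "\<not> asc s w"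
  shows "asc s (tconj s w)"
proof (cases "s \<otimes> w = w \<otimes> star s")
  case True
  then have t: "tconj s w = s \<otimes> w" by (simp add: tconj_def)
  have "s \<otimes> (s \<otimes> w) = w" using s w by simp
  then show ?thesis using d s w not_asc_iff[of s w] t by simp
next
  case False
  have l: "len w = Suc (len (s \<otimes> w))" using d s w not_asc_iff by simp
  define v where "v = s \<otimes> w"
  have v: "v \<in> carrier W" "s \<otimes> v = w" using s w by (simp_all add: v_def)
  have r: "len (w \<otimes> star s) = len v" using len_right_star[OF s w] by (simp add: v_def)
  show ?thesis
  proof (rule ccontr)
    assume "\<not> asc s (tconj s w)"
    then have n: "\<not> len (v \<otimes> star s) < len v"
      using False s w r by (simp add: tconj_def m_assoc v_def)
    then have "len (v \<otimes> star s) = Suc (len v)" using len_right_cases[of "star s" v] s v by auto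
    then have "s \<otimes> v = v \<otimes> star s"
      using left_right_ascent_fold[of s "star s" v] s v l r by (auto simp: v_def)
    then have "w \<otimes> star s = v" using v s by simp
    then show False using False by (simp add: v_def)
  qed
qed

lemma asc_tconj: "s \<in> S \<Longrightarrow> w \<in> I \<Longrightarrow> asc s (tconj s w) \<longleftrightarrow> \<not> asc s w"
  using tconj_desc_asc[of s w] tconj_asc_len[of s w] by auto

lemma tconj_desc_len:
  assumes s: "s \<in> S" and w: "w \<in> I" and d: "\<not> asc s w"
  shows "len (tconj s w) < len w"
  using tconj_asc_len[OF s, of "tconj s w"] tconj_desc_asc[OF assms] s w by simp

lemma tconj_neq: "s \<in> S \<Longrightarrow> w \<in> I \<Longrightarrow> tconj s w \<noteq> w"
  using asc_tconj[of s w] by metis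

text \<open>A left descent \<open>s\<close> of w makes \<open>tconj s w\<close> shorter with
  \<open>s\<close> as an ascent, and \<open>tconj s\<close> leads back to w.\<close>

lemma I_induct [consumes 1, case_names one tconj]:
  assumes "w \<in> I" "P \<one>"
    and "\<And>s v. s \<in> S \<Longrightarrow> v \<in> I \<Longrightarrow> asc s v \<Longrightarrow> P v \<Longrightarrow> P (tconj s v)"
  shows "P w"
  using assms(1)
proof (induction "len w" arbitrary: w rule: less_induct)
  case less
  show ?case
  proof (cases "w = \<one>")
    case False
    obtain s where s: "s \<in> S" "len w = Suc (len (s \<otimes> w))"
      using exists_left_descent[of w] False less.prems by auto
    then have d: "\<not> asc s w" by simp
    have "P (tconj s (tconj s w))"
      using s d less.prems tconj_desc_asc[of s w] tconj_desc_len[of s w]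
      by (intro assms(3) less.hyps) auto
    then show ?thesis using s less.prems by simp
  qed (use assms in simp)
qed

lemma left_mult_induct [consumes 1, case_names one step]:
  assumes "w \<in> carrier W" "P \<one>"
    and "\<And>s v. s \<in> S \<Longrightarrow> v \<in> carrier W \<Longrightarrow> asc s v \<Longrightarrow> P v \<Longrightarrow> P (s \<otimes> v)"
  shows "P w"
  using assms(1)
proof (induction "len w" arbitrary: w rule: less_induct)
  case less
  show ?case
  proof (cases "w = \<one>")
    case False
    obtain s where s: "s \<in> S" "len w = Suc (len (s \<otimes> w))"
      using exists_left_descent[of w] False less.prems by auto
    have "P (s \<otimes> (s \<otimes> w))"
      using s less.prems by (intro assms(3) less.hyps) auto
    then show ?thesis using s less.prems by simp
  qed (use assms in simp)
qed

section \<open>Alternating words in a generator and its image\<close>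

primrec alt :: "'a \<Rightarrow> nat \<Rightarrow> 'a" where
  "alt s 0 = \<one>"
| "alt s (Suc n) = s \<otimes> alt (star s) n"

text \<open>For x = \<open>alt s n\<close> this is x (star x)^-1, the twisted conjugate of 1 by x,
  written so that each step is a twisted conjugation by one letter.\<close>

primrec alt_inv :: "'a \<Rightarrow> nat \<Rightarrow> 'a" where
  "alt_inv s 0 = \<one>"
| "alt_inv s (Suc n) = s \<otimes> alt_inv (star s) n \<otimes> star s"

lemma alt_closed [simp]: "s \<in> S \<Longrightarrow> alt s n \<in> carrier W"
  by (induction n arbitrary: s) auto

lemma alt_inv_in_I: "s \<in> S \<Longrightarrow> alt_inv s n \<in> I"
proof (induction n arbitrary: s)
  case (Suc n)
  then have "alt_inv (star s) n \<in> I" by simp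
  then show ?case using Suc.prems
    by (auto simp: inv_mult_group star_star m_assoc I_star intro!: I_I)
qed simp

lemma star_alt: "s \<in> S \<Longrightarrow> star (alt s n) = alt (star s) n"
  by (induction n arbitrary: s) auto

text \<open>Unless it is empty, the inverse word ends in \<open>star s\<close>, so the concatenation
  is still alternating; its first letter depends on the parity of \<open>k\<close>.\<close>

lemma alt_mult_alt: "s \<in> S \<Longrightarrow> inv (alt (star s) k) \<otimes> alt s j = alt ((star ^^ k) s) (k + j)"
proof (induction k arbitrary: s j)
  case (Suc k)
  have "inv (alt (star s) (Suc k)) \<otimes> alt s j = inv (alt (star (star s)) k) \<otimes> alt (star s) (Suc j)"
    using Suc.prems by (simp add: inv_mult_group m_assoc star_star)
  also have "\<dots> = alt ((star ^^ k) (star s)) (k + Suc j)" using Suc.IH[of "star s" "Suc j"] Suc.prems by simp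
  finally show ?case by (simp add: funpow_swap1)
qed simp

lemma alt_double_snoc:
  "s \<in> S \<Longrightarrow> alt s (2 * n) \<otimes> s = alt s (Suc (2 * n))"
  by (induction n arbitrary: s) (auto simp: m_assoc star_star)

lemma alt_inv_eq: "s \<in> S \<Longrightarrow> alt_inv s n = alt s (2 * n)"
proof (induction n arbitrary: s)
  case (Suc n)
  then have "alt_inv s (Suc n) = s \<otimes> (alt (star s) (2 * n) \<otimes> star s)" by (simp add: m_assoc)
  also have "\<dots> = alt s (2 * Suc n)" using Suc.prems by (simp add: alt_double_snoc)
  finally show ?case .
qed simp

text \<open>This includes the case \<open>a = a\<^sup>*\<close>, in which \<open>ws\<close> must be empty.\<close>

lemma reduced_alt:
  "reduced (a # ws) \<Longrightarrow> a \<in> S \<Longrightarrow> set ws \<subseteq> {a, star a} \<Longrightarrow> word_prod W (a # ws) = alt a (Suc (length ws))"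
proof (induction ws arbitrary: a)
  case (Cons b ws)
  have b: "b \<in> S" and ws: "ws \<in> lists S" using Cons.prems reduced_lists by auto
  have "b \<noteq> a"
  proof
    assume "b = a"
    then have "word_prod W (a # b # ws) = word_prod W ws" using b ws by simp
    then show False using Cons.prems(1) len_word_le[OF ws] by (simp add: reduced_def)
  qed
  then have "b = star a" using Cons.prems by auto
  moreover have "word_prod W (b # ws) = alt b (Suc (length ws))"
    using Cons.prems b reduced_tl[of a "b # ws"] calculation by (intro Cons.IH) (auto simp: star_star)
  ultimately show ?case by simp
qed simp

end


section \<open>Integral polynomials in the inverse of the indeterminate\<close>

text \<open>In the order on \<open>rat poly\<close> that \<open>Qu\<close> inherits, a polynomial is
  positive iff its leading coefficient is.\<close>

lemma of_nat_less_u: "of_nat n < u"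
proof -
  have "(of_nat n :: Qu) = Fract (of_nat n) 1" by (induction n) (simp_all add: Zero_fract_def One_fract_def)
  moreover have "of_nat n < ([:0, 1:] :: rat poly)"
    by (simp add: less_poly_def pos_poly_def of_nat_poly)
  ultimately show ?thesis by (simp add: u_def)
qed

lemma u_gt_1: "1 < u"
  using of_nat_less_u[of 1] by simp

lemma u_pos [simp]: "0 < u" "u \<noteq> 0" "0 \<le> u"
  using u_gt_1 by auto

lemma int_poly_uinv_0 [simp]: "int_poly_uinv 0 = 0"
  by (simp add: int_poly_uinv_def)

lemma int_poly_uinv_pCons:
  "int_poly_uinv (pCons a p) = of_int a + inverse u * int_poly_uinv p"
  by (simp add: int_poly_uinv_def map_poly_pCons)

lemma int_poly_uinv_add: "int_poly_uinv (p + q) = int_poly_uinv p + int_poly_uinv q"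
  by (induction p q rule: poly_induct2) (simp_all add: int_poly_uinv_pCons algebra_simps)

lemma int_poly_uinv_smult: "int_poly_uinv (smult c p) = of_int c * int_poly_uinv p"
  by (induction p) (simp_all add: int_poly_uinv_pCons algebra_simps)

lemma int_poly_uinv_mult: "int_poly_uinv (p * q) = int_poly_uinv p * int_poly_uinv q"
  by (induction p)
     (simp_all add: int_poly_uinv_pCons int_poly_uinv_add int_poly_uinv_smult algebra_simps)

lemma int_poly_uinv_bounded: "\<exists>n. \<bar>int_poly_uinv p\<bar> \<le> of_nat n"
proof (induction p)
  case (pCons a p)
  then obtain n where n: "\<bar>int_poly_uinv p\<bar> \<le> of_nat n" by blast
  have "\<bar>inverse u * int_poly_uinv p\<bar> \<le> 1 * \<bar>int_poly_uinv p\<bar>"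
    using u_gt_1 unfolding abs_mult by (intro mult_right_mono) (auto simp: inverse_le_1_iff)
  then have "\<bar>int_poly_uinv (pCons a p)\<bar> \<le> \<bar>of_int a\<bar> + of_nat n"
    using n unfolding int_poly_uinv_pCons by linarith
  also have "\<dots> = of_nat (nat \<bar>a\<bar> + n)" by simp
  finally show ?case by blast
qed auto

text \<open>A polynomial in u^-1 is bounded by a natural number because u^-1 is at most 1; one more
  factor u^-1 makes it infinitely small.\<close>

lemma inverse_u_int_poly_small:
  assumes "n > 0"
  shows "\<bar>inverse u * int_poly_uinv p\<bar> < inverse (of_nat n)"
proof -
  obtain m where m: "\<bar>int_poly_uinv p\<bar> \<le> of_nat m" using int_poly_uinv_bounded by blast
  have "of_nat n * \<bar>int_poly_uinv p\<bar> \<le> of_nat n * of_nat m" using m by (intro mult_left_mono) auto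
  also have "\<dots> < u" using of_nat_less_u[of "n * m"] by simp
  finally show ?thesis using assms by (simp add: abs_mult field_simps)
qed

text \<open>The other terms being infinitely small, the constant term is an integer of absolute
  value below 1, hence 0; then u^-1 is cancelled. The order alone thus gives the independence of the
  powers of u^-1.\<close>

lemma int_poly_uinv_eq_0: "int_poly_uinv p = 0 \<Longrightarrow> p = 0"
proof (induction p)
  case (pCons a p)
  have "\<bar>of_int a :: Qu\<bar> < 1"
    using pCons.prems inverse_u_int_poly_small[of 1 p] unfolding int_poly_uinv_pCons
    by (simp add: add_eq_0_iff2)
  then have "of_int \<bar>a\<bar> < (of_int 1 :: Qu)" by simp
  then have "a = 0" unfolding of_int_less_iff by simp
  then show ?case using pCons by (simp add: int_poly_uinv_pCons)
qed simp

lemma int_poly_uinv_inj: "int_poly_uinv p = int_poly_uinv q \<Longrightarrow> p = q"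
  using int_poly_uinv_eq_0[of "p - q"] int_poly_uinv_add[of "p - q" q] by simp

text \<open>Joins membership in Z[u^-1] with the value at u^-1 = 0. As a relation it passes directly
  through sums and products, without the description operator in \<open>eval_uinv_0\<close>.\<close>

definition uinv_val :: "Qu \<Rightarrow> int \<Rightarrow> bool" where
  "uinv_val c k \<longleftrightarrow> (\<exists>p. int_poly_uinv p = c \<and> poly p 0 = k)"

lemma uinv_val_Z_uinv: "uinv_val c k \<Longrightarrow> c \<in> Z_uinv"
  by (auto simp: uinv_val_def Z_uinv_def)

lemma uinv_val_eval: "uinv_val c k \<Longrightarrow> eval_uinv_0 c = k"
  unfolding uinv_val_def eval_uinv_0_def using int_poly_uinv_inj by (metis (mono_tags) the_equality)

lemma uinv_val_add: "uinv_val c k \<Longrightarrow> uinv_val d l \<Longrightarrow> uinv_val (c + d) (k + l)"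
  unfolding uinv_val_def using int_poly_uinv_add poly_add by metis

lemma uinv_val_mult: "uinv_val c k \<Longrightarrow> uinv_val d l \<Longrightarrow> uinv_val (c * d) (k * l)"
  unfolding uinv_val_def using int_poly_uinv_mult poly_mult by metis

lemma uinv_val_of_int: "uinv_val (of_int k) k"
  unfolding uinv_val_def by (rule exI[of _ "[:k:]"]) (simp add: int_poly_uinv_pCons)

lemma uinv_val_inverse_u: "uinv_val (inverse u) 0"
  unfolding uinv_val_def by (rule exI[of _ "[:0, 1:]"]) (simp add: int_poly_uinv_pCons)

lemma uinv_val_diff: "uinv_val c k \<Longrightarrow> uinv_val d l \<Longrightarrow> uinv_val (c - d) (k - l)"
  using uinv_val_add[of c k "of_int (-1) * d" "-1 * l"] uinv_val_mult[OF uinv_val_of_int[of "-1"], of d l]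
  by simp

text \<open>The terms with a positive power of u^-1 are infinitely small.\<close>

lemma uinv_val_near:
  assumes "uinv_val c k" "n > 0"
  shows "\<bar>c - of_int k\<bar> < inverse (of_nat n)"
proof -
  obtain p where p: "int_poly_uinv p = c" "poly p 0 = k" using assms by (auto simp: uinv_val_def)
  obtain a q where "p = pCons a q" by (cases p)
  then show ?thesis using p inverse_u_int_poly_small[OF assms(2), of q] by (auto simp: int_poly_uinv_pCons)
qed


section \<open>Formal sums and multiplication in the Hecke algebra\<close>

lemma scal_apply [simp]: "(c *q f) x = c * f x"
  by (simp add: scal_def)

lemma finite_sums_bvec [simp]: "w \<in> A \<Longrightarrow> bvec w \<in> finite_sums A"
  by (auto simp: finite_sums_def formal_sums_def bvec_def)

lemma finite_sums_0 [simp]: "0 \<in> finite_sums A"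
  by (simp add: finite_sums_def formal_sums_def)

lemma finite_sums_add [simp]:
  "f \<in> finite_sums A \<Longrightarrow> g \<in> finite_sums A \<Longrightarrow> f + g \<in> finite_sums A"
  unfolding finite_sums_def formal_sums_def
  by (auto intro: finite_subset[of _ "{x. f x \<noteq> 0} \<union> {x. g x \<noteq> 0}"])

lemma finite_sums_scal [simp]: "f \<in> finite_sums A \<Longrightarrow> c *q f \<in> finite_sums A"
  unfolding finite_sums_def formal_sums_def
  by (auto intro: finite_subset[of _ "{x. f x \<noteq> 0}"])

lemma finite_sums_outside: "f \<in> finite_sums A \<Longrightarrow> x \<notin> A \<Longrightarrow> f x = 0"
  by (simp add: finite_sums_def formal_sums_def)

lemma scal_bvec_add_upd: "f = f a *q bvec a + f(a := 0)"
  by (auto simp: bvec_def fun_eq_iff)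

lemma finite_sums_upd: "f \<in> finite_sums A \<Longrightarrow> f(a := 0) \<in> finite_sums A"
  unfolding finite_sums_def formal_sums_def
  by (auto intro: finite_subset[of _ "{x. f x \<noteq> 0}"])

lemma finite_sums_induct [consumes 1, case_names zero add]:
  assumes f: "f \<in> finite_sums A" and zero: "P 0"
    and add: "\<And>c w g. w \<in> A \<Longrightarrow> g \<in> finite_sums A \<Longrightarrow> P g \<Longrightarrow> P (c *q bvec w + g)"
  shows "P f"
proof -
  have "P f" if "finite B" "{x. f x \<noteq> 0} \<subseteq> B" "B \<subseteq> A" "f \<in> finite_sums A" for B f
    using that
  proof (induction B arbitrary: f rule: finite_induct)
    case empty
    then have "f = 0" by (auto simp: fun_eq_iff)
    then show "P f" using zero by simp
  next
    case (insert a B)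
    have "P (f(a := 0))" using insert.prems by (intro insert.IH finite_sums_upd) auto
    then have "P (f a *q bvec a + f(a := 0))"
      using insert.prems by (intro add finite_sums_upd) auto
    then show "P f" using scal_bvec_add_upd[of f a] by simp
  qed
  from this[of "{x. f x \<noteq> 0}" f] f show ?thesis
    by (auto simp: finite_sums_def formal_sums_def)
qed

lemma linear_expand:
  fixes F :: "('i \<Rightarrow> Qu) \<Rightarrow> Qu"
  assumes "finite B" "B \<subseteq> A" "f \<in> finite_sums A" "{x. f x \<noteq> 0} \<subseteq> B"
    and zero: "F 0 = 0"
    and lin: "\<And>c w g. w \<in> A \<Longrightarrow> g \<in> finite_sums A \<Longrightarrow> F (c *q bvec w + g) = c * F (bvec w) + F g"
  shows "F f = (\<Sum>w\<in>B. f w * F (bvec w))"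
  using assms(1-4)
proof (induction B arbitrary: f rule: finite_induct)
  case empty
  then have "f = 0" by (auto simp: fun_eq_iff)
  then show "F f = (\<Sum>w\<in>{}. f w * F (bvec w))" using zero by simp
next
  case (insert a B)
  define g where "g = f(a := 0)"
  have g: "g \<in> finite_sums A" "{x. g x \<noteq> 0} \<subseteq> B"
    using insert.prems finite_sums_upd[of f A a] by (auto simp: g_def)
  have "f = f a *q bvec a + g" unfolding g_def by (rule scal_bvec_add_upd)
  then have "F f = F (f a *q bvec a + g)" by simp
  also have "\<dots> = f a * F (bvec a) + F g" using insert.prems g by (intro lin) auto
  also have "F g = (\<Sum>w\<in>B. g w * F (bvec w))" using insert.prems g by (intro insert.IH) auto
  also have "\<dots> = (\<Sum>w\<in>B. f w * F (bvec w))"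
    using insert.hyps by (intro sum.cong) (auto simp: g_def)
  finally show "F f = (\<Sum>w\<in>insert a B. f w * F (bvec w))" using insert.hyps by simp
qed

section \<open>Multiplication by basis elements and the trace form\<close>

locale hecke_involution_module = twisted_coxeter W S star
  for W (structure) and S and star +
  fixes H :: "('a \<Rightarrow> Qu, 'c) ring_scheme" and act :: "('a \<Rightarrow> Qu) \<Rightarrow> ('a \<Rightarrow> Qu) \<Rightarrow> 'a \<Rightarrow> Qu"
  assumes hecke: "hecke_algebra W S H"
    and inv_module: "involution_module W S star H act"
begin

abbreviation mH :: "('a \<Rightarrow> Qu) \<Rightarrow> ('a \<Rightarrow> Qu) \<Rightarrow> 'a \<Rightarrow> Qu" (infixl "\<bullet>" 70) where
  "h \<bullet> k \<equiv> h \<otimes>\<^bsub>H\<^esub> k"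

abbreviation Hs :: "('a \<Rightarrow> Qu) set" where "Hs \<equiv> finite_sums (carrier W)"

abbreviation Ms :: "('a \<Rightarrow> Qu) set" where "Ms \<equiv> finite_sums I"

lemma ring_H: "ring H"
  and carrier_H: "carrier H = Hs"
  using hecke by (simp_all add: hecke_algebra_def)

lemma H_add: "h \<in> Hs \<Longrightarrow> k \<in> Hs \<Longrightarrow> h \<oplus>\<^bsub>H\<^esub> k = h + k"
  using hecke by (simp add: hecke_algebra_def)

lemma mH_closed [simp]: "h \<in> Hs \<Longrightarrow> k \<in> Hs \<Longrightarrow> h \<bullet> k \<in> Hs"
  using ring_H carrier_H by (metis ring.ring_simprules(5))

lemma mH_assoc: "h \<in> Hs \<Longrightarrow> k \<in> Hs \<Longrightarrow> m \<in> Hs \<Longrightarrow> (h \<bullet> k) \<bullet> m = h \<bullet> (k \<bullet> m)"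
  using ring_H carrier_H by (metis ring.ring_simprules(11))

lemma mH_scal:
  assumes "h \<in> Hs" "k \<in> Hs"
  shows "(c *q h) \<bullet> k = c *q (h \<bullet> k)" "h \<bullet> (c *q k) = c *q (h \<bullet> k)"
  using hecke assms by (simp_all add: hecke_algebra_def)

lemma mH_add_left: "h \<in> Hs \<Longrightarrow> k \<in> Hs \<Longrightarrow> m \<in> Hs \<Longrightarrow> (h + k) \<bullet> m = h \<bullet> m + k \<bullet> m"
  using ring.ring_simprules(13)[OF ring_H, of h k m] by (simp add: carrier_H H_add)

lemma mH_add_right: "h \<in> Hs \<Longrightarrow> k \<in> Hs \<Longrightarrow> m \<in> Hs \<Longrightarrow> m \<bullet> (h + k) = m \<bullet> h + m \<bullet> k"
  using ring.ring_simprules(23)[OF ring_H, of h k m] by (simp add: carrier_H H_add)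

lemma H_zero: "\<zero>\<^bsub>H\<^esub> = 0"
proof -
  have z: "\<zero>\<^bsub>H\<^esub> \<in> Hs" using ring.ring_simprules(2)[OF ring_H] carrier_H by simp
  have "\<zero>\<^bsub>H\<^esub> \<oplus>\<^bsub>H\<^esub> \<zero>\<^bsub>H\<^esub> = \<zero>\<^bsub>H\<^esub>" using z carrier_H ring.ring_simprules(8)[OF ring_H] by simp
  then have "\<zero>\<^bsub>H\<^esub> + \<zero>\<^bsub>H\<^esub> = \<zero>\<^bsub>H\<^esub>" using H_add z by simp
  then show ?thesis by (metis add_cancel_right_right)
qed

lemma mH_zero [simp]: "h \<in> Hs \<Longrightarrow> 0 \<bullet> h = 0" "h \<in> Hs \<Longrightarrow> h \<bullet> 0 = 0"
  using ring.ring_simprules(24,25)[OF ring_H, of h] by (simp_all add: carrier_H H_zero)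

lemma T_mult:
  "v \<in> carrier W \<Longrightarrow> w \<in> carrier W \<Longrightarrow> len (v \<otimes> w) = len v + len w \<Longrightarrow> bvec v \<bullet> bvec w = bvec (v \<otimes> w)"
  using hecke by (simp add: hecke_algebra_def)

lemma one_H_closed: "\<one>\<^bsub>H\<^esub> \<in> Hs"
  using ring.ring_simprules(6)[OF ring_H] carrier_H by simp

lemma bvec_one_left: "h \<in> Hs \<Longrightarrow> bvec \<one> \<bullet> h = h"
proof (induction h rule: finite_sums_induct)
  case (add c w g)
  show "bvec \<one> \<bullet> (c *q bvec w + g) = c *q bvec w + g"
    using add by (simp add: mH_add_right mH_scal T_mult)
next
  case zero
  show "bvec \<one> \<bullet> 0 = 0" by simp
qed

text \<open>The product of T_1 with the abstract unit is the unit, since T_1 is a left unit, and it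
  is also T_1.\<close>

lemma H_one: "\<one>\<^bsub>H\<^esub> = bvec \<one>"
  using bvec_one_left[OF one_H_closed] monoid.r_one[OF ring.is_monoid[OF ring_H], of "bvec \<one>"]
  by (simp add: carrier_H)

lemma bvec_one_right: "h \<in> Hs \<Longrightarrow> h \<bullet> bvec \<one> = h"
  using monoid.r_one[OF ring.is_monoid[OF ring_H], of h] by (simp add: carrier_H H_one)

lemma T_square:
  assumes s: "s \<in> S"
  shows "bvec s \<bullet> bvec s = (u\<^sup>2 - 1) *q bvec s + u\<^sup>2 *q bvec \<one>"
proof -
  have sc: "bvec s \<in> Hs" "bvec \<one> \<in> Hs" using s by auto
  \<comment> \<open>The second factor of the quadratic relation is known only through the
    subtraction of the ring. Adding u^2 T_1 back expresses T_s by \<open>y\<close>, and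
    \<open>y\<close> is killed by T_s + T_1.\<close>
  define y where "y = bvec s \<ominus>\<^bsub>H\<^esub> (u\<^sup>2 *q \<one>\<^bsub>H\<^esub>)"
  interpret R: ring H by (rule ring_H)
  have uc: "u\<^sup>2 *q bvec \<one> \<in> carrier H" using sc by (simp add: carrier_H)
  have yc: "y \<in> Hs" using sc uc R.minus_closed by (simp add: y_def H_one flip: carrier_H)
  have "y \<oplus>\<^bsub>H\<^esub> (u\<^sup>2 *q \<one>\<^bsub>H\<^esub>) = bvec s"
    using sc uc unfolding y_def H_one carrier_H[symmetric]
    by (simp add: R.minus_eq R.a_assoc R.l_neg)
  then have y: "bvec s = y + u\<^sup>2 *q bvec \<one>" using H_add yc sc by (simp add: H_one)
  have "(bvec s \<oplus>\<^bsub>H\<^esub> \<one>\<^bsub>H\<^esub>) \<bullet> y = \<zero>\<^bsub>H\<^esub>"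
    using hecke s by (simp add: hecke_algebra_def y_def)
  then have q: "(bvec s + bvec \<one>) \<bullet> y = 0" using sc by (simp add: H_add H_one H_zero)
  have "(bvec s + bvec \<one>) \<bullet> bvec s = (bvec s + bvec \<one>) \<bullet> y + (bvec s + bvec \<one>) \<bullet> (u\<^sup>2 *q bvec \<one>)"
    using sc yc by (subst y, subst mH_add_right[symmetric]) auto
  then have "bvec s \<bullet> bvec s + bvec s = u\<^sup>2 *q (bvec s + bvec \<one>)"
    using q sc by (simp add: mH_scal bvec_one_right mH_add_left bvec_one_left)
  then show ?thesis by (auto simp: fun_eq_iff algebra_simps)
qed

lemma T_left:
  assumes s: "s \<in> S" and w: "w \<in> carrier W"
  shows "bvec s \<bullet> bvec w =
    (if asc s w then bvec (s \<otimes> w) else (u\<^sup>2 - 1) *q bvec w + u\<^sup>2 *q bvec (s \<otimes> w))"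
proof (cases "asc s w")
  case True
  then show ?thesis using assms asc_iff[of s w] by (simp add: T_mult)
next
  case False
  define v where "v = s \<otimes> w"
  have v: "v \<in> carrier W" "s \<otimes> v = w" using assms by (simp_all add: v_def)
  have l: "len w = Suc (len v)" using False assms not_asc_iff by (simp add: v_def)
  have "bvec w = bvec s \<bullet> bvec v" using T_mult[of s v] s v l by simp
  then have "bvec s \<bullet> bvec w = (bvec s \<bullet> bvec s) \<bullet> bvec v" using s v by (simp add: mH_assoc)
  also have "\<dots> = (u\<^sup>2 - 1) *q (bvec s \<bullet> bvec v) + u\<^sup>2 *q bvec v"
    using s v by (simp add: T_square mH_add_left mH_scal bvec_one_left)
  also have "\<dots> = (u\<^sup>2 - 1) *q bvec w + u\<^sup>2 *q bvec v" using \<open>bvec w = _\<close> by simp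
  finally show ?thesis using False by (simp add: v_def)
qed

lemma T_right:
  assumes s: "s \<in> S" and w: "w \<in> carrier W"
  shows "bvec w \<bullet> bvec s =
    (if len w < len (w \<otimes> s) then bvec (w \<otimes> s) else (u\<^sup>2 - 1) *q bvec w + u\<^sup>2 *q bvec (w \<otimes> s))"
proof (cases "len w < len (w \<otimes> s)")
  case True
  then show ?thesis using assms len_right_cases[of s w] by (simp add: T_mult)
next
  case False
  define v where "v = w \<otimes> s"
  have v: "v \<in> carrier W" "v \<otimes> s = w" using assms by (simp_all add: v_def)
  have l: "len w = Suc (len v)" using False assms len_right_cases[of s w] by (auto simp: v_def)
  have "bvec w = bvec v \<bullet> bvec s" using T_mult[of v s] s v l by simp
  then have "bvec w \<bullet> bvec s = bvec v \<bullet> (bvec s \<bullet> bvec s)" using s v by (simp add: mH_assoc)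
  also have "\<dots> = (u\<^sup>2 - 1) *q (bvec v \<bullet> bvec s) + u\<^sup>2 *q bvec v"
    using s v by (simp add: T_square mH_add_right mH_scal bvec_one_right)
  also have "\<dots> = (u\<^sup>2 - 1) *q bvec w + u\<^sup>2 *q bvec v" using \<open>bvec w = _\<close> by simp
  finally show ?thesis using False by (simp add: v_def)
qed

text \<open>The transpose of \<open>T_left\<close>: the contributions to T_z come from T_z and T_(s
  z), and z is an ascent exactly when s z is a descent.\<close>

lemma T_left_coeff:
  assumes s: "s \<in> S" and h: "h \<in> Hs" and z: "z \<in> carrier W"
  shows "(bvec s \<bullet> h) z = (if asc s z then u\<^sup>2 * h (s \<otimes> z) else h (s \<otimes> z) + (u\<^sup>2 - 1) * h z)"
  using h
proof (induction h rule: finite_sums_induct)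
  case (add c w g)
  have e: "s \<otimes> z = w \<longleftrightarrow> z = s \<otimes> w" using S_left_eq_iff[OF s z] add by simp
  have "(bvec s \<bullet> bvec w) z =
    (if asc s z then u\<^sup>2 * bvec w (s \<otimes> z) else bvec w (s \<otimes> z) + (u\<^sup>2 - 1) * bvec w z)"
    unfolding T_left[OF s add(1)] using asc_mult[OF s add(1)] asc_mult[OF s z] s z add(1) e
    by (auto simp: bvec_def)
  then show "(bvec s \<bullet> (c *q bvec w + g)) z = (if asc s z then u\<^sup>2 * (c *q bvec w + g) (s \<otimes> z)
      else (c *q bvec w + g) (s \<otimes> z) + (u\<^sup>2 - 1) * (c *q bvec w + g) z)"
    using add s by (simp add: mH_add_right mH_scal distrib_left mult.left_commute)
next
  case zero
  show "(bvec s \<bullet> 0) z = (if asc s z then u\<^sup>2 * 0 (s \<otimes> z) else 0 (s \<otimes> z) + (u\<^sup>2 - 1) * 0 z)"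
    using s by simp
qed

lemma T_right_coeff:
  assumes s: "s \<in> S" and h: "h \<in> Hs" and z: "z \<in> carrier W"
  shows "(h \<bullet> bvec s) z =
    (if len z < len (z \<otimes> s) then u\<^sup>2 * h (z \<otimes> s) else h (z \<otimes> s) + (u\<^sup>2 - 1) * h z)"
  using h
proof (induction h rule: finite_sums_induct)
  case (add c w g)
  have e: "z \<otimes> s = w \<longleftrightarrow> z = w \<otimes> s" using s z add(1) by auto
  have rasc: "len (x \<otimes> s) < len (x \<otimes> s \<otimes> s) \<longleftrightarrow> \<not> len x < len (x \<otimes> s)" if "x \<in> carrier W" for x
    using len_right_cases[OF s that] s that by auto
  have "(bvec w \<bullet> bvec s) z =
    (if len z < len (z \<otimes> s) then u\<^sup>2 * bvec w (z \<otimes> s) else bvec w (z \<otimes> s) + (u\<^sup>2 - 1) * bvec w z)"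
    unfolding T_right[OF s add(1)] using rasc[OF add(1)] rasc[OF z] s z add(1) e
    by (auto simp: bvec_def)
  then show "((c *q bvec w + g) \<bullet> bvec s) z =
      (if len z < len (z \<otimes> s) then u\<^sup>2 * (c *q bvec w + g) (z \<otimes> s)
      else (c *q bvec w + g) (z \<otimes> s) + (u\<^sup>2 - 1) * (c *q bvec w + g) z)"
    using add s by (simp add: mH_add_left mH_scal distrib_left mult.left_commute)
next
  case zero
  show "(0 \<bullet> bvec s) z =
      (if len z < len (z \<otimes> s) then u\<^sup>2 * 0 (z \<otimes> s) else 0 (z \<otimes> s) + (u\<^sup>2 - 1) * 0 z)"
    using s by simp
qed

text \<open>Additivity of lengths forces \<open>s\<close> to be an ascent of the current z at every
  step, so the diagonal term u^2 - 1 never occurs and each letter contributes one factor u^2. The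
  case z = 1 is the trace form.\<close>

lemma T_coeff_length_additive:
  assumes "y \<in> carrier W" "z \<in> carrier W" "g \<in> Hs" "len (inv y \<otimes> z) = len y + len z"
  shows "(bvec y \<bullet> g) z = u ^ (2 * len y) * g (inv y \<otimes> z)"
  using assms
proof (induction y arbitrary: z rule: left_mult_induct)
  case (step s v)
  have l: "len (s \<otimes> v) = Suc (len v)" using step asc_iff by simp
  have e: "inv (s \<otimes> v) \<otimes> z = inv v \<otimes> (s \<otimes> z)" using step by (simp add: inv_mult_group m_assoc)
  have "len (inv v \<otimes> (s \<otimes> z)) \<le> len v + len (s \<otimes> z)" using len_mult_le[of "inv v" "s \<otimes> z"] step by simp
  then have a: "asc s z" and lz: "len (s \<otimes> z) = Suc (len z)"
    using step.prems l e len_left_cases[of s z] step.hyps by auto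
  have "bvec (s \<otimes> v) = bvec s \<bullet> bvec v" using step l by (simp add: T_mult)
  then have "(bvec (s \<otimes> v) \<bullet> g) z = (bvec s \<bullet> (bvec v \<bullet> g)) z" using step by (simp add: mH_assoc)
  also have "\<dots> = u\<^sup>2 * (bvec v \<bullet> g) (s \<otimes> z)" using step a by (subst T_left_coeff) auto
  also have "\<dots> = u\<^sup>2 * (u ^ (2 * len v) * g (inv v \<otimes> (s \<otimes> z)))"
    using step.prems step.hyps e l lz by (subst step.IH) auto
  finally show ?case using l e by (simp add: power2_eq_square)
qed (simp add: bvec_one_left)

lemma T_trace_left:
  "x \<in> carrier W \<Longrightarrow> g \<in> Hs \<Longrightarrow> (bvec (inv x) \<bullet> g) \<one> = u ^ (2 * len x) * g x"
  using T_coeff_length_additive[of "inv x" "\<one>" g] by simp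

text \<open>Symmetry of the trace form: the T_1-coefficient of T_w T_y vanishes unless w and y are
  inverse to each other, and then l(w) = l(y).\<close>

lemma T_trace_right:
  assumes y: "y \<in> carrier W" and g: "g \<in> Hs"
  shows "(g \<bullet> bvec y) \<one> = u ^ (2 * len y) * g (inv y)"
  using g
proof (induction g rule: finite_sums_induct)
  case (add c w g)
  have "(bvec w \<bullet> bvec y) \<one> = u ^ (2 * len w) * bvec y (inv w)"
    using T_trace_left[of "inv w" "bvec y"] add y by simp
  also have "\<dots> = u ^ (2 * len y) * bvec w (inv y)"
    using add y by (auto simp: bvec_def)
  finally show "((c *q bvec w + g) \<bullet> bvec y) \<one> = u ^ (2 * len y) * (c *q bvec w + g) (inv y)"
    using add y by (simp add: mH_add_left mH_scal distrib_left mult.left_commute)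
next
  case zero
  show "(0 \<bullet> bvec y) \<one> = u ^ (2 * len y) * 0 (inv y)" using y by simp
qed

text \<open>Both sides come from the coefficient of \<open>T\<^sub>1\<close> in \<open>T\<^bsub>x\<inverse>\<^esub> h T\<^sub>y\<close>.\<close>

lemma T_adjoint:
  assumes "x \<in> carrier W" "y \<in> carrier W" "h \<in> Hs"
  shows "u ^ (2 * len x) * (h \<bullet> bvec y) x = u ^ (2 * len y) * (bvec (inv x) \<bullet> h) (inv y)"
  using T_trace_left[of x "h \<bullet> bvec y"] T_trace_right[of y "bvec (inv x) \<bullet> h"] assms
  by (simp add: mH_assoc)

end


section \<open>The module of twisted involutions\<close>

context hecke_involution_module
begin

abbreviation comm :: "'a \<Rightarrow> 'a \<Rightarrow> bool" where "comm s w \<equiv> s \<otimes> w = w \<otimes> star s"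

text \<open>With \<open>tconj\<close> the four cases of the action become one: T_s a_w has this
  coefficient at a_w and \<open>off_coeff\<close> at a_(tconj s w). Among the ascents only the
  commuting ones have a nonzero diagonal entry.\<close>

definition diag_coeff :: "'a \<Rightarrow> 'a \<Rightarrow> Qu" where
  "diag_coeff s w = (if asc s w then (if comm s w then u else 0)
     else (if comm s w then u\<^sup>2 - u - 1 else u\<^sup>2 - 1))"

definition off_coeff :: "'a \<Rightarrow> 'a \<Rightarrow> Qu" where
  "off_coeff s w = (if asc s w then (if comm s w then u + 1 else 1)
     else (if comm s w then u\<^sup>2 - u else u\<^sup>2))"

lemma hecke_module_M: "hecke_module H Ms act"
  using inv_module by (simp add: involution_module_def)

lemma act_closed [simp]: "h \<in> Hs \<Longrightarrow> v \<in> Ms \<Longrightarrow> act h v \<in> Ms"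
  using hecke_module_M by (simp add: hecke_module_def carrier_H)

lemma act_add_right: "h \<in> Hs \<Longrightarrow> v \<in> Ms \<Longrightarrow> v' \<in> Ms \<Longrightarrow> act h (v + v') = act h v + act h v'"
  using hecke_module_M by (simp add: hecke_module_def carrier_H)

lemma act_add_left: "h \<in> Hs \<Longrightarrow> k \<in> Hs \<Longrightarrow> v \<in> Ms \<Longrightarrow> act (h + k) v = act h v + act k v"
  using hecke_module_M by (simp add: hecke_module_def carrier_H flip: H_add)

lemma act_mult: "h \<in> Hs \<Longrightarrow> k \<in> Hs \<Longrightarrow> v \<in> Ms \<Longrightarrow> act (h \<bullet> k) v = act h (act k v)"
  using hecke_module_M by (simp add: hecke_module_def carrier_H)

lemma act_one [simp]: "v \<in> Ms \<Longrightarrow> act (bvec \<one>) v = v"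
  using hecke_module_M by (simp add: hecke_module_def H_one)

lemma act_scal:
  "h \<in> Hs \<Longrightarrow> v \<in> Ms \<Longrightarrow> act (c *q h) v = c *q act h v"
  "h \<in> Hs \<Longrightarrow> v \<in> Ms \<Longrightarrow> act h (c *q v) = c *q act h v"
  using hecke_module_M by (simp_all add: hecke_module_def carrier_H)

lemma act_zero [simp]:
  "h \<in> Hs \<Longrightarrow> act h 0 = 0" "v \<in> Ms \<Longrightarrow> act 0 v = 0"
proof -
  have z: "0 *q f = 0" for f :: "'a \<Rightarrow> Qu" by (auto simp: fun_eq_iff)
  show "h \<in> Hs \<Longrightarrow> act h 0 = 0" using act_scal(2)[of h 0 0] by (simp add: z)
  show "v \<in> Ms \<Longrightarrow> act 0 v = 0" using act_scal(1)[of 0 v 0] by (simp add: z)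
qed

lemma act_T_mult:
  "x \<in> carrier W \<Longrightarrow> y \<in> carrier W \<Longrightarrow> len (x \<otimes> y) = len x + len y \<Longrightarrow> v \<in> Ms \<Longrightarrow>
    act (bvec (x \<otimes> y)) v = act (bvec x) (act (bvec y) v)"
  using T_mult[of x y] act_mult[of "bvec x" "bvec y" v] by simp

lemma cox_less_asc:
  assumes "s \<in> S" "w \<in> carrier W"
  shows "cox_less W S w (s \<otimes> w) \<longleftrightarrow> asc s w" "cox_less W S (s \<otimes> w) w \<longleftrightarrow> \<not> asc s w"
proof -
  have "w \<otimes> inv (s \<otimes> w) = s" "s \<otimes> w \<otimes> inv w = s"
    using assms by (simp_all add: inv_mult_group m_assoc flip: m_assoc[of w "inv w" s])
  then show "cox_less W S w (s \<otimes> w) \<longleftrightarrow> asc s w" "cox_less W S (s \<otimes> w) w \<longleftrightarrow> \<not> asc s w"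
    using asc_iff[OF assms] not_asc_iff[OF assms] assms by (auto simp: cox_less_def)
qed

lemma act_bvec:
  assumes s: "s \<in> S" and w: "w \<in> I"
  shows "act (bvec s) (bvec w) = diag_coeff s w *q bvec w + off_coeff s w *q bvec (tconj s w)"
proof -
  have m: "(comm s w \<and> asc s w \<longrightarrow> act (bvec s) (bvec w) = u *q bvec w + (u + 1) *q bvec (s \<otimes> w)) \<and>
    (comm s w \<and> \<not> asc s w \<longrightarrow>
       act (bvec s) (bvec w) = (u\<^sup>2 - u - 1) *q bvec w + (u\<^sup>2 - u) *q bvec (s \<otimes> w)) \<and>
    (\<not> comm s w \<and> asc s w \<longrightarrow> act (bvec s) (bvec w) = bvec (s \<otimes> w \<otimes> star s)) \<and>
    (\<not> comm s w \<and> \<not> asc s w \<longrightarrow>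
       act (bvec s) (bvec w) = (u\<^sup>2 - 1) *q bvec w + u\<^sup>2 *q bvec (s \<otimes> w \<otimes> star s))"
    using inv_module s w cox_less_asc[OF s I_carrier[OF w]]
    unfolding involution_module_def Let_def by blast
  have "0 *q bvec w + 1 *q bvec x = bvec x" for x by (auto simp: fun_eq_iff)
  then show ?thesis using m by (auto simp: diag_coeff_def off_coeff_def tconj_def)
qed

text \<open>Since \<open>tconj s\<close> is an involution of \<open>I\<close>, the coefficient at
  a_z is fed only by a_z and a_(tconj s z).\<close>

lemma act_T_coeff:
  assumes s: "s \<in> S" and v: "v \<in> Ms" and z: "z \<in> I"
  shows "act (bvec s) v z = diag_coeff s z * v z + off_coeff s (tconj s z) * v (tconj s z)"
  using v
proof (induction v rule: finite_sums_induct)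
  case (add c w g)
  have e: "tconj s z = w \<longleftrightarrow> z = tconj s w" using s z add(1) by auto
  have "act (bvec s) (bvec w) z = diag_coeff s z * bvec w z + off_coeff s (tconj s z) * bvec w (tconj s z)"
    using e act_bvec[OF s add(1)] by (auto simp: bvec_def)
  then show "act (bvec s) (c *q bvec w + g) z =
      diag_coeff s z * (c *q bvec w + g) z + off_coeff s (tconj s z) * (c *q bvec w + g) (tconj s z)"
    using add s by (simp add: act_add_right act_scal distrib_left mult.left_commute)
next
  case zero
  show "act (bvec s) 0 z = diag_coeff s z * 0 z + off_coeff s (tconj s z) * 0 (tconj s z)"
    using s by simp
qed

lemma act_expand:
  assumes "finite A" "A \<subseteq> carrier W" "g \<in> Hs" "{x. g x \<noteq> 0} \<subseteq> A" "v \<in> Ms"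
  shows "act g v z = (\<Sum>w\<in>A. g w * act (bvec w) v z)"
  using assms(5) by (intro linear_expand[OF assms(1-4), of "\<lambda>g. act g v z"]) (simp_all add: act_add_left act_scal)

text \<open>By \<open>T_adjoint\<close> this is the only candidate for \<open>\<mu>\<close> with \<open>\<mu>(v)\<^sub>1\<close> the coefficient of \<open>a\<^sub>1\<close> in \<open>v\<close>.\<close>

definition muf :: "('a \<Rightarrow> Qu) \<Rightarrow> 'a \<Rightarrow> Qu" where
  "muf v x = (if x \<in> carrier W then inverse u ^ (2 * len x) * act (bvec (inv x)) v \<one> else 0)"

lemma muf_formal: "muf v \<in> formal_sums (carrier W)"
  by (simp add: muf_def formal_sums_def)

lemma muf_add: "v \<in> Ms \<Longrightarrow> v' \<in> Ms \<Longrightarrow> muf (v + v') = muf v + muf v'"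
  by (auto simp: muf_def fun_eq_iff act_add_right distrib_left)

text \<open>With w = y^-1, \<open>T_adjoint\<close> turns the coefficients of h T_y at x into those
  of T_(x^-1) h at w. The sum over y becomes the expansion of T_(x^-1) h acting on v.\<close>

lemma muf_act:
  assumes h: "h \<in> Hs" and v: "v \<in> Ms"
  shows "muf (act h v) = hat_act W H h (muf v)"
proof
  fix x
  show "muf (act h v) x = hat_act W H h (muf v) x"
  proof (cases "x \<in> carrier W")
    case False
    then have "(h \<bullet> bvec y) x = 0" if "y \<in> carrier W" for y
      using h that by (intro finite_sums_outside[of _ "carrier W"]) auto
    then have "{y \<in> carrier W. (h \<bullet> bvec y) x \<noteq> 0} = {}" by auto
    then show ?thesis using False by (simp add: muf_def hat_act_def)
  next
    case x: True
    define k where "k = bvec (inv x) \<bullet> h"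
    have k: "k \<in> Hs" using h x by (simp add: k_def)
    define Y where "Y = {y \<in> carrier W. (h \<bullet> bvec y) x \<noteq> 0}"
    define A where "A = {y. k y \<noteq> 0}"
    have A: "finite A" "A \<subseteq> carrier W" using k by (auto simp: A_def finite_sums_def formal_sums_def)
    have ad: "u ^ (2 * len x) * (h \<bullet> bvec y) x = u ^ (2 * len y) * k (inv y)" if "y \<in> carrier W" for y
      using T_adjoint[OF x that h] by (simp add: k_def)
    have Y: "y \<in> Y \<longleftrightarrow> inv y \<in> A" if "y \<in> carrier W" for y
    proof -
      have "u ^ (2 * len x) * (h \<bullet> bvec y) x \<noteq> 0 \<longleftrightarrow> u ^ (2 * len y) * k (inv y) \<noteq> 0"
        using ad[OF that] by simp
      then show ?thesis using that by (simp add: Y_def A_def)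
    qed
    \<comment> \<open>Inversion matches the index set in \<open>hat_act\<close> with the support of
      \<open>k\<close>, which also shows that the former is finite.\<close>
    have bij: "bij_betw (\<lambda>y. inv y) Y A"
    proof (rule bij_betw_byWitness[where f' = "\<lambda>y. inv y"])
      show "\<forall>y\<in>Y. inv (inv y) = y" by (auto simp: Y_def)
      show "\<forall>y\<in>A. inv (inv y) = y" using A by auto
      show "(\<lambda>y. inv y) ` Y \<subseteq> A" using Y by (auto simp: Y_def)
      show "(\<lambda>y. inv y) ` A \<subseteq> Y" using Y A by (metis image_subsetI inv_closed inv_inv subsetD)
    qed
    have "hat_act W H h (muf v) x = (\<Sum>y\<in>Y. muf v y * (h \<bullet> bvec y) x)"
      by (simp add: hat_act_def Y_def)
    also have "\<dots> = (\<Sum>y\<in>Y. inverse u ^ (2 * len x) * (k (inv y) * act (bvec (inv y)) v \<one>))"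
    proof (rule sum.cong[OF HOL.refl])
      fix y assume "y \<in> Y"
      then have y: "y \<in> carrier W" by (simp add: Y_def)
      have "(h \<bullet> bvec y) x = inverse u ^ (2 * len x) * (u ^ (2 * len y) * k (inv y))"
        using ad[OF y] by (simp add: field_simps)
      then show "muf v y * (h \<bullet> bvec y) x = inverse u ^ (2 * len x) * (k (inv y) * act (bvec (inv y)) v \<one>)"
        using y by (simp add: muf_def field_simps)
    qed
    also have "\<dots> = inverse u ^ (2 * len x) * (\<Sum>y\<in>Y. k (inv y) * act (bvec (inv y)) v \<one>)"
      by (simp add: sum_distrib_left)
    also have "(\<Sum>y\<in>Y. k (inv y) * act (bvec (inv y)) v \<one>) = (\<Sum>w\<in>A. k w * act (bvec w) v \<one>)"
      by (rule sum.reindex_bij_betw[OF bij, of "\<lambda>w. k w * act (bvec w) v \<one>"])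
    also have "\<dots> = act k v \<one>" using act_expand[of A k v \<one>] A k v by (simp add: A_def)
    also have "act k v = act (bvec (inv x)) (act h v)" using x h v by (simp add: k_def act_mult)
    finally show ?thesis using x by (simp add: muf_def[of "act h v"])
  qed
qed

text \<open>At an ascent the off-diagonal entry is 1 or u + 1, hence invertible, and the formula for
  T_s a_v can be solved for a_(tconj s v).\<close>

lemma bvec_in_span_one:
  assumes "w \<in> I"
  shows "\<exists>h\<in>Hs. act h (bvec \<one>) = bvec w"
  using assms
proof (induction w rule: I_induct)
  case one
  show ?case by (intro bexI[of _ "bvec \<one>"]) auto
next
  case (tconj s v)
  obtain h where h: "h \<in> Hs" "act h (bvec \<one>) = bvec v" using tconj by blast
  have c: "off_coeff s v \<noteq> 0" using tconj(3) u_gt_1 by (simp add: off_coeff_def)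
  define c where "c = off_coeff s v"
  define d where "d = diag_coeff s v"
  \<comment> \<open>Encodes c^-1 (T_s - d) h, the solution for the new basis vector.\<close>
  define k where "k = inverse c *q (bvec s \<bullet> h + (- d) *q h)"
  have "act k (bvec \<one>) = inverse c *q (act (bvec s) (bvec v) + (- d) *q bvec v)"
    using h tconj(1) by (simp add: k_def act_scal act_add_left act_mult)
  also have "\<dots> = bvec (tconj s v)"
    using c by (auto simp: act_bvec[OF tconj(1,2)] fun_eq_iff c_def d_def)
  finally have "act k (bvec \<one>) = bvec (tconj s v)" .
  moreover have "k \<in> Hs" using h tconj(1) by (simp add: k_def)
  ultimately show ?case by blast
qed

lemma M_cyclic:
  assumes "v \<in> Ms"
  shows "\<exists>h\<in>Hs. act h (bvec \<one>) = v"
  using assms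
proof (induction v rule: finite_sums_induct)
  case zero
  show "\<exists>h\<in>Hs. act h (bvec \<one>) = 0" by (intro bexI[of _ 0]) auto
next
  case (add c w g)
  obtain h where "h \<in> Hs" "act h (bvec \<one>) = bvec w" using bvec_in_span_one[OF add(1)] by blast
  moreover obtain k where "k \<in> Hs" "act k (bvec \<one>) = g" using add by blast
  ultimately have "act (c *q h + k) (bvec \<one>) = c *q bvec w + g" "c *q h + k \<in> Hs"
    by (simp_all add: act_add_left act_scal)
  then show "\<exists>h\<in>Hs. act h (bvec \<one>) = c *q bvec w + g" by blast
qed

end


section \<open>The image of the generator\<close>

context hecke_involution_module
begin

section \<open>Positivity and the support of T_x a_1\<close>

definition tw_square :: "'a \<Rightarrow> 'a \<Rightarrow> Qu" where
  "tw_square x = bvec x \<bullet> bvec (inv (star x))"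

lemma tw_square_closed [simp]: "x \<in> carrier W \<Longrightarrow> tw_square x \<in> Hs"
  by (simp add: tw_square_def)

text \<open>Multiplication by T_s on the left and by T_(star s) on the right imitates s w (star s),
  so this step runs parallel to one application of T_s on M.\<close>

lemma tw_square_step:
  assumes s: "s \<in> S" and v: "v \<in> carrier W" and a: "asc s v"
  shows "tw_square (s \<otimes> v) = (bvec s \<bullet> tw_square v) \<bullet> bvec (star s)"
proof -
  have l: "len (s \<otimes> v) = Suc (len v)" using assms asc_iff by simp
  have 1: "bvec (s \<otimes> v) = bvec s \<bullet> bvec v" using T_mult[of s v] s v l by simp
  have e: "inv (star (s \<otimes> v)) = inv (star v) \<otimes> star s" using s v by (simp add: inv_mult_group)
  have "len (inv (star v) \<otimes> star s) = Suc (len v)"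
    using l s v len_inv[of "star (s \<otimes> v)"] len_star[of "s \<otimes> v"] by (simp add: inv_mult_group del: star_inv)
  then have 2: "bvec (inv (star (s \<otimes> v))) = bvec (inv (star v)) \<bullet> bvec (star s)"
    using T_mult[of "inv (star v)" "star s"] s v e by simp
  show ?thesis unfolding tw_square_def 1 2 using s v by (simp add: mH_assoc)
qed

lemma u_square_minus_1: "0 < u\<^sup>2 - 1"
  using u_gt_1 by (simp add: one_less_power)

text \<open>The coefficients 1, u^2 and u^2 - 1 of the formula are all positive, so a single
  positive contribution is enough.\<close>

lemma T_left_nonneg:
  assumes s: "s \<in> S" and h: "h \<in> Hs" and nn: "\<And>z. 0 \<le> h z"
  shows "0 \<le> (bvec s \<bullet> h) z"
    and "z \<in> carrier W \<Longrightarrow> 0 < h (s \<otimes> z) \<or> \<not> asc s z \<and> 0 < h z \<Longrightarrow> 0 < (bvec s \<bullet> h) z"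
proof -
  note c = T_left_coeff[OF s h, of z]
  show "0 \<le> (bvec s \<bullet> h) z"
  proof (cases "z \<in> carrier W")
    case True
    then show ?thesis using c nn u_square_minus_1 by simp
  qed (use s h finite_sums_outside[of "bvec s \<bullet> h" "carrier W" z] in simp)
  assume z: "z \<in> carrier W" "0 < h (s \<otimes> z) \<or> \<not> asc s z \<and> 0 < h z"
  have "0 \<le> (u\<^sup>2 - 1) * h z" using nn u_square_minus_1 by simp
  moreover have "0 < h z \<Longrightarrow> 0 < (u\<^sup>2 - 1) * h z" using u_square_minus_1 by simp
  ultimately show "0 < (bvec s \<bullet> h) z" using c z nn[of "s \<otimes> z"]
    by (auto intro: add_pos_nonneg add_nonneg_pos)
qed

lemma T_right_nonneg:
  assumes s: "s \<in> S" and h: "h \<in> Hs" and nn: "\<And>z. 0 \<le> h z"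
  shows "0 \<le> (h \<bullet> bvec s) z"
    and "z \<in> carrier W \<Longrightarrow> 0 < h (z \<otimes> s) \<or> \<not> len z < len (z \<otimes> s) \<and> 0 < h z \<Longrightarrow> 0 < (h \<bullet> bvec s) z"
proof -
  note c = T_right_coeff[OF s h, of z]
  show "0 \<le> (h \<bullet> bvec s) z"
  proof (cases "z \<in> carrier W")
    case True
    then show ?thesis using c nn u_square_minus_1 by simp
  qed (use s h finite_sums_outside[of "h \<bullet> bvec s" "carrier W" z] in simp)
  assume z: "z \<in> carrier W" "0 < h (z \<otimes> s) \<or> \<not> len z < len (z \<otimes> s) \<and> 0 < h z"
  have "0 \<le> (u\<^sup>2 - 1) * h z" using nn u_square_minus_1 by simp
  moreover have "0 < h z \<Longrightarrow> 0 < (u\<^sup>2 - 1) * h z" using u_square_minus_1 by simp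
  ultimately show "0 < (h \<bullet> bvec s) z" using c z nn[of "z \<otimes> s"]
    by (auto intro: add_pos_nonneg add_nonneg_pos)
qed

text \<open>Since \<open>u\<^sup>2 - 1 > 0\<close> in the ordered field, no cancellation occurs in \<open>T\<^sub>x T\<^bsub>x*\<inverse>\<^esub>\<close>, and its support
  dominates that of \<open>T\<^sub>x a\<^sub>1\<close>.\<close>

lemma act_support:
  assumes "x \<in> carrier W"
  shows "(\<forall>z. 0 \<le> tw_square x z) \<and> (\<forall>z. act (bvec x) (bvec \<one>) z \<noteq> 0 \<longrightarrow> 0 < tw_square x z)"
  using assms
proof (induction x rule: left_mult_induct)
  case one
  have "tw_square \<one> = bvec \<one>" by (simp add: tw_square_def bvec_one_left)
  moreover have "act (bvec \<one>) (bvec \<one>) = bvec \<one>" by simp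
  ultimately show ?case by (simp only: bvec_def) simp
next
  case (step s v)
  define h where "h = tw_square v"
  define k where "k = bvec s \<bullet> h"
  define m where "m = act (bvec v) (bvec \<one>)"
  define t where "t = star s"
  have s: "s \<in> S" and v: "v \<in> carrier W" and t: "t \<in> S" using step by (auto simp: t_def)
  have h: "h \<in> Hs" "\<And>z. 0 \<le> h z" and m: "m \<in> Ms" "\<And>z. m z \<noteq> 0 \<Longrightarrow> 0 < h z"
    using step by (auto simp: h_def m_def)
  have k: "k \<in> Hs" using s h by (simp add: k_def)
  note k1 = T_left_nonneg[OF s h, folded k_def]
  have e: "tw_square (s \<otimes> v) = k \<bullet> bvec t"
    using tw_square_step[OF step(1,2,3)] by (simp add: k_def h_def t_def)
  note r1 = T_right_nonneg[OF t k k1(1), folded e]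
  have "act (bvec (s \<otimes> v)) (bvec \<one>) = act (bvec s) m"
    using act_T_mult[OF S_carrier[OF s] v, of "bvec \<one>"] asc_iff[OF s v] step(3) s by (simp add: m_def)
  moreover have "0 < tw_square (s \<otimes> v) z" if nz: "act (bvec s) m z \<noteq> 0" for z
  proof -
    have z: "z \<in> I" using nz s m finite_sums_outside[of "act (bvec s) m" I z] by auto
    have zt: "z \<otimes> t \<in> carrier W" using z t by simp
    have lz: "len (z \<otimes> t) = len (s \<otimes> z)" using len_right_star[OF s z] by (simp add: t_def)
    have nz': "diag_coeff s z * m z + off_coeff s (tconj s z) * m (tconj s z) \<noteq> 0"
      using nz act_T_coeff[OF s m(1) z] by simp
    have A: "0 < h (s \<otimes> z \<otimes> t) \<Longrightarrow> 0 < tw_square (s \<otimes> v) z"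
      using k1(2)[OF zt] r1(2)[of z] s z t by (simp add: m_assoc)
    show ?thesis
    proof (cases "asc s z")
      case False
      \<comment> \<open>At a descent both the left and the right multiplication have a diagonal term
        at \<open>z\<close>.\<close>
      have B: "0 < h z \<or> 0 < h (s \<otimes> z) \<Longrightarrow> 0 < tw_square (s \<otimes> v) z"
        using k1(2)[of z] r1(2)[of z] z False lz by auto
      have "m z \<noteq> 0 \<or> m (tconj s z) \<noteq> 0" using nz' by auto
      then have "0 < h z \<or> 0 < h (tconj s z)" using m(2) by blast
      then show ?thesis using A B by (auto simp: tconj_def t_def split: if_splits)
    next
      case True
      show ?thesis
      proof (cases "comm s z")
        case c: True
        \<comment> \<open>Here positivity takes a detour: s z is a descent, so the left
          multiplication makes s z = z t positive, and the right one moves this to z.\<close>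
        have "z \<otimes> t = s \<otimes> z" using c by (simp add: t_def)
        moreover have "\<not> asc s (s \<otimes> z)" using asc_mult[of s z] s z True by simp
        moreover have "m z \<noteq> 0 \<or> m (tconj s z) \<noteq> 0" using nz' by auto
        then have "0 < h z \<or> 0 < h (s \<otimes> z)" using m(2) c by (auto simp: tconj_def)
        ultimately show ?thesis using k1(2)[OF zt] r1(2)[of z] s z by auto
      next
        case False
        then have "diag_coeff s z = 0" using True by (simp add: diag_coeff_def)
        then have "m (tconj s z) \<noteq> 0" using nz' by auto
        then show ?thesis using A m(2) False by (simp add: tconj_def t_def)
      qed
    qed
  qed
  ultimately show ?case using r1(1) by simp
qed

text \<open>By orthogonality under the trace form, T_1 occurs in the product of T_x with the basis
  element of (star x)^-1 only if star x = x; the support bound carries this over to a_1.\<close>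

lemma coeff_one_nonfixed:
  assumes x: "x \<in> carrier W" and n: "star x \<noteq> x"
  shows "act (bvec x) (bvec \<one>) \<one> = 0"
proof (rule ccontr)
  assume "act (bvec x) (bvec \<one>) \<one> \<noteq> 0"
  then have "0 < tw_square x \<one>" using act_support[OF x] by blast
  also have "tw_square x \<one> = u ^ (2 * len x) * bvec x (star x)"
    using T_trace_right[of "inv (star x)" "bvec x"] x by (simp add: tw_square_def del: star_inv)
  also have "\<dots> = 0" using n by (simp add: bvec_def)
  finally show False by simp
qed

section \<open>The dihedral case\<close>

lemma alt_add: "c \<in> S \<Longrightarrow> alt c (i + j) = alt c i \<otimes> alt ((star ^^ i) c) j"
proof (induction i arbitrary: c)
  case (Suc i)
  then have "alt c (Suc i + j) = c \<otimes> (alt (star c) i \<otimes> alt ((star ^^ i) (star c)) j)" by simp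
  then show ?case using Suc.prems star_funpow_in_S[of "star c" i] by (simp add: m_assoc funpow_swap1)
qed (simp)

lemma len_alt_le: "c \<in> S \<Longrightarrow> len (alt c n) \<le> n"
proof (induction n arbitrary: c)
  case (Suc n)
  have "len (alt (star c) n) \<le> n" using Suc.prems by (intro Suc.IH) simp
  then show ?case using len_mult_le[of c "alt (star c) n"] Suc.prems by simp
qed simp

lemma len_alt_prefix:
  assumes "c \<in> S" "len (alt c m) = m" "j \<le> m"
  shows "len (alt c j) = j"
proof -
  have "alt c m = alt c j \<otimes> alt ((star ^^ j) c) (m - j)" using alt_add[of c j "m - j"] assms by simp
  moreover have "len (alt ((star ^^ j) c) (m - j)) \<le> m - j" "(star ^^ j) c \<in> S"
    using assms star_funpow_in_S len_alt_le by simp_all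
  ultimately have "m \<le> len (alt c j) + (m - j)"
    using len_mult_le[of "alt c j" "alt ((star ^^ j) c) (m - j)"] assms by simp
  then show ?thesis using len_alt_le[of c j] assms by simp
qed

text \<open>If the two alternating words of length j + 1 agreed, the first two letters of the word
  of length j + 2 would cancel.\<close>

lemma alt_neq_star:
  assumes "c \<in> S" "len (alt c (Suc (Suc j))) = Suc (Suc j)"
  shows "alt c (Suc j) \<noteq> alt (star c) (Suc j)"
proof
  assume "alt c (Suc j) = alt (star c) (Suc j)"
  then have "alt c (Suc (Suc j)) = c \<otimes> alt c (Suc j)" by simp
  also have "\<dots> = alt (star c) j" using assms by simp
  finally show False using assms len_alt_le[of "star c" j] by simp
qed

text \<open>\<open>c w\<close> and \<open>w star c\<close> are the two alternating words of length 2
  j + 1, which differ as long as a longer one is reduced. The strict bound in the last claim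
  matters: at 2 j + 1 = m they may agree.\<close>

lemma alt_inv_step:
  assumes c: "c \<in> S" and l: "len (alt c m) = m" "len (alt (star c) m) = m" and j: "2 * j < m"
  defines "w \<equiv> alt_inv (star c) j"
  shows "w \<in> I" "asc c w" "c \<otimes> w = alt c (2 * j + 1)" "w \<otimes> star c = alt (star c) (2 * j + 1)"
    and "Suc (2 * j) < m \<Longrightarrow> \<not> comm c w \<and> tconj c w = alt_inv c (Suc j)"
proof -
  have w: "w = alt (star c) (2 * j)" using c by (simp add: w_def alt_inv_eq)
  show "w \<in> I" using c by (simp add: w_def alt_inv_in_I)
  show cw: "c \<otimes> w = alt c (2 * j + 1)" using c by (simp add: w)
  show wc: "w \<otimes> star c = alt (star c) (2 * j + 1)" using c alt_double_snoc[of "star c" j] by (simp add: w)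
  have "len w = 2 * j" "len (c \<otimes> w) = 2 * j + 1"
    using len_alt_prefix[of "star c" m "2 * j"] len_alt_prefix[of c m "2 * j + 1"] c l j cw w by simp_all
  then show "asc c w" by simp
  assume j': "Suc (2 * j) < m"
  have "\<not> comm c w"
    using alt_neq_star[of c "2 * j"] len_alt_prefix[of c m "Suc (Suc (2 * j))"] j' c l cw wc by simp
  then show "\<not> comm c w \<and> tconj c w = alt_inv c (Suc j)" by (simp add: tconj_def w_def)
qed

text \<open>In this range each letter is an ascent outside the commuting case, with entries 0 and 1,
  so a single basis vector survives. Its index has 2 j letters, whence the bound.\<close>

lemma act_alt:
  "c \<in> S \<Longrightarrow> len (alt c m) = m \<Longrightarrow> len (alt (star c) m) = m \<Longrightarrow> 2 * j \<le> m \<Longrightarrow>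
    act (bvec (alt c j)) (bvec \<one>) = bvec (alt_inv c j)"
proof (induction j arbitrary: c)
  case (Suc j)
  define w where "w = alt_inv (star c) j"
  note st = alt_inv_step[OF Suc.prems(1-3), of j, folded w_def]
  have IH: "act (bvec (alt (star c) j)) (bvec \<one>) = bvec w"
    using Suc.IH[of "star c"] Suc.prems by (simp add: star_star w_def)
  have "len (alt c (Suc j)) = Suc j" "len (alt (star c) j) = j"
    using len_alt_prefix[of c m "Suc j"] len_alt_prefix[of "star c" m j] Suc.prems by auto
  then have "act (bvec (alt c (Suc j))) (bvec \<one>) = act (bvec c) (bvec w)"
    using act_T_mult[of c "alt (star c) j" "bvec \<one>"] Suc.prems IH by simp
  also have "\<dots> = 0 *q bvec w + 1 *q bvec (alt_inv c (Suc j))"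
    using act_bvec[of c w] st Suc.prems by (simp add: diag_coeff_def off_coeff_def del: alt_inv.simps)
  also have "\<dots> = bvec (alt_inv c (Suc j))" by (auto simp: fun_eq_iff)
  finally show ?case .
qed simp

text \<open>The transposed computation: followed backwards, a_1 is fed only by a_(alt_inv c j), and
  each of the j letters contributes the off-diagonal entry u^2 of a noncommuting descent.\<close>

lemma act_inv_alt:
  "c \<in> S \<Longrightarrow> len (alt c m) = m \<Longrightarrow> len (alt (star c) m) = m \<Longrightarrow> 2 * j \<le> m \<Longrightarrow> v \<in> Ms \<Longrightarrow>
    act (bvec (inv (alt c j))) v \<one> = u ^ (2 * j) * v (alt_inv c j)"
proof (induction j arbitrary: c v)
  case (Suc j)
  define w where "w = alt_inv (star c) j"
  note st = alt_inv_step[OF Suc.prems(1-3), of j, folded w_def]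
  have c: "c \<in> S" and v: "v \<in> Ms" and sc: "star c \<in> S" using Suc.prems by simp_all
  have tc: "tconj c w = alt_inv c (Suc j)" "\<not> comm c w" "w \<in> I" "asc c w" using st Suc.prems by simp_all
  have e: "inv (alt c (Suc j)) = inv (alt (star c) j) \<otimes> c" using c by (simp add: inv_mult_group)
  have "len (alt c (Suc j)) = Suc j" "len (alt (star c) j) = j"
    using len_alt_prefix[of c m "Suc j"] len_alt_prefix[of "star c" m j] Suc.prems by auto
  then have "len (inv (alt (star c) j) \<otimes> c) = Suc j" "len (inv (alt (star c) j)) = j"
    using len_inv[OF alt_closed[OF c, of "Suc j"]] len_inv[OF alt_closed[OF sc, of j]] e by simp_all
  then have "act (bvec (inv (alt c (Suc j)))) v = act (bvec (inv (alt (star c) j))) (act (bvec c) v)"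
    using act_T_mult[of "inv (alt (star c) j)" c v] c v e by simp
  then have "act (bvec (inv (alt c (Suc j)))) v \<one> = u ^ (2 * j) * act (bvec c) v w"
    using Suc.IH[of "star c" "act (bvec c) v"] Suc.prems by (simp add: star_star w_def)
  also have "act (bvec c) v w = u\<^sup>2 * v (alt_inv c (Suc j))"
  proof -
    have "diag_coeff c w = 0" using tc by (simp add: diag_coeff_def)
    moreover have "off_coeff c (tconj c w) = u\<^sup>2"
      using asc_tconj[OF c tc(3)] tconj_comm_iff[OF c I_carrier[OF tc(3)]] tc by (simp add: off_coeff_def)
    ultimately show ?thesis using act_T_coeff[OF c v tc(3)] tc(1) by simp
  qed
  finally show ?case by (simp add: power2_eq_square)
qed simp

text \<open>The hypothesis says that the word is fixed by the automorphism. For m = 2 k both halves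
  lead to the same basis vector and the factor is u^(2 k); for m = 2 k + 1 the middle letter adds
  the factor u.\<close>

lemma coeff_one_dihedral:
  assumes c: "c \<in> S" and d: "alt c m = alt (star c) m" and l: "len (alt c m) = m"
  shows "act (bvec (alt c m)) (bvec \<one>) \<one> = u ^ m"
proof -
  have l': "len (alt (star c) m) = m" using d l by simp
  have sc: "star c \<in> S" "star (star c) = c" using c by (simp_all add: star_star)
  \<comment> \<open>The first letter is immaterial because the two alternating words of length m
    coincide; so the parity of \<open>k\<close> in \<open>alt_mult_alt\<close> does not
    matter.\<close>
  have fp: "alt ((star ^^ k) c) m = alt c m" for k
  proof -
    have "(star ^^ k) c = c \<or> (star ^^ k) c = star c" by (induction k) (use sc in auto)
    then show ?thesis using d by auto
  qed
  \<comment> \<open>The part given to the functional is rounded down to satisfy 2 k \<le> m. For odd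
    m the other part is one letter too long for \<open>act_alt\<close>.\<close>
  define k where "k = m div 2"
  define j where "j = m - k"
  have kj: "k + j = m" "2 * k \<le> m" by (auto simp: k_def j_def)
  have "alt c m = inv (alt (star c) k) \<otimes> alt c j"
    using alt_mult_alt[OF c, of k j] fp kj by simp
  moreover have "len (alt c j) = j" "len (alt (star c) k) = k"
    using len_alt_prefix[of c m j] len_alt_prefix[of "star c" m k] c l l' kj by auto
  ultimately have "act (bvec (alt c m)) (bvec \<one>) = 
      act (bvec (inv (alt (star c) k))) (act (bvec (alt c j)) (bvec \<one>))"
    using act_T_mult[of "inv (alt (star c) k)" "alt c j" "bvec \<one>"] c l kj by simp
  then have t: "act (bvec (alt c m)) (bvec \<one>) \<one> =
      u ^ (2 * k) * act (bvec (alt c j)) (bvec \<one>) (alt_inv (star c) k)"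
    using act_inv_alt[of "star c" m k "act (bvec (alt c j)) (bvec \<one>)"] sc c l l' kj by simp
  show ?thesis
  proof (cases "even m")
    case True
    then have jk: "j = k" "m = 2 * k" by (auto simp: j_def k_def)
    have "alt_inv c k = alt_inv (star c) k" using d jk c by (simp add: alt_inv_eq)
    then have "act (bvec (alt c j)) (bvec \<one>) (alt_inv (star c) k) = 1"
      using act_alt[OF c l l', of k] jk by (simp add: bvec_def)
    then show ?thesis using t jk by simp
  next
    case False
    then have jk: "m = 2 * k + 1" "j = Suc k" unfolding j_def k_def by presburger+
    define w where "w = alt_inv (star c) k"
    note st = alt_inv_step[OF c l l', of k, folded w_def]
    have "len (alt (star c) k) = k" "len (alt c j) = j" using \<open>len (alt c j) = j\<close> \<open>len (alt (star c) k) = k\<close> by auto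
    then have "act (bvec (alt c j)) (bvec \<one>) = act (bvec c) (act (bvec (alt (star c) k)) (bvec \<one>))"
      using act_T_mult[of c "alt (star c) k" "bvec \<one>"] c jk by simp
    also have "\<dots> = act (bvec c) (bvec w)"
      using act_alt[of "star c" m k] sc l l' jk by (simp add: w_def)
    finally have "act (bvec (alt c j)) (bvec \<one>) w = diag_coeff c w"
      using act_bvec[of c w] c st tconj_neq[of c w] jk by (auto simp: bvec_def)
    \<comment> \<open>Now 2 k + 1 = m, so the two alternating words agree and this is a commuting
      ascent.\<close>
    also have "\<dots> = u" using st jk d by (simp add: diag_coeff_def)
    finally show ?thesis using t jk by (simp add: w_def)
  qed
qed

text \<open>For a star-stable J, \<open>tconj\<close> by a letter of J preserves the parabolic
  subgroup. Coefficients inside it are therefore fed only from inside it.\<close>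

lemma act_parabolic_local:
  assumes J: "J \<subseteq> S" "star ` J \<subseteq> J" and v: "v \<in> Ms" "v' \<in> Ms"
    and eq: "\<And>z. z \<in> parabolic J \<Longrightarrow> v z = v' z" and d: "d \<in> parabolic J" and z: "z \<in> parabolic J"
  shows "act (bvec d) v z = act (bvec d) v' z"
proof -
  obtain ws where ws: "ws \<in> lists J" "reduced ws" "word_prod W ws = d" using parabolic_reduced[OF J(1) d] .
  have "act (bvec (word_prod W ws)) v z = act (bvec (word_prod W ws)) v' z"
    using ws(1,2) z
  proof (induction ws arbitrary: z rule: list.induct)
    case Nil
    then show ?case using v eq by simp
  next
    case (Cons b ws)
    define w where "w = word_prod W ws"
    have b: "b \<in> J" "b \<in> S" "star b \<in> J" and wsl: "ws \<in> lists J" "ws \<in> lists S"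
      using Cons.prems J lists_subset[OF J(1)] by auto
    have r: "reduced ws" using Cons.prems(2) by (rule reduced_tl)
    have w: "w \<in> carrier W" using wsl by (simp add: w_def)
    have l: "len (b \<otimes> w) = Suc (len w)" using Cons.prems(2) r by (simp add: reduced_def w_def)
    have e: "act (bvec (word_prod W (b # ws))) x = act (bvec b) (act (bvec w) x)" if "x \<in> Ms" for x
      using act_T_mult[of b w x] that b w l by (simp add: w_def)
    have zc: "z \<in> carrier W" using parabolic_carrier[OF J(1)] Cons.prems by simp
    show ?case
    proof (cases "z \<in> I")
      case True
      have "tconj b z \<in> parabolic J" using b Cons.prems(3) J parabolic_mult[OF J(1)] parabolic_gen[OF J(1)]
        by (simp add: tconj_def)
      then have "act (bvec w) v (tconj b z) = act (bvec w) v' (tconj b z)" "act (bvec w) v z = act (bvec w) v' z"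
        using Cons.IH[OF wsl(1) r] Cons.prems(3) by (simp_all add: w_def)
      then show ?thesis using e v act_T_coeff[OF b(2) _ True] w by simp
    next
      case False
      have "act (bvec b) (act (bvec w) x) z = 0" if "x \<in> Ms" for x
        using that b w False by (intro finite_sums_outside[of _ I]) auto
      then show ?thesis using e v by simp
    qed
  qed
  then show ?thesis using ws by simp
qed

lemma star_parabolic:
  assumes "J \<subseteq> S" "star ` J \<subseteq> J" "w \<in> parabolic J"
  shows "star w \<in> parabolic J"
proof -
  obtain ws where ws: "ws \<in> lists J" "w = word_prod W ws" using assms by (auto simp: parabolic_def)
  have "map star ws \<in> lists J" using ws assms by (auto simp: in_lists_conv_set)
  moreover have "star w = word_prod W (map star ws)"
    using ws word_prod_map_star[of ws] lists_subset[OF assms(1)] by simp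
  ultimately show ?thesis by (auto simp: parabolic_def)
qed

text \<open>Both factors of x = d y are fixed by the automorphism. On the parabolic subgroup T_y a_1
  agrees with a multiple of a_1, and the a_1-coefficient after T_d depends on nothing else.\<close>

lemma coeff_one_fixed:
  assumes "x \<in> carrier W" "star x = x"
  shows "act (bvec x) (bvec \<one>) \<one> = u ^ len x"
  using assms
proof (induction "len x" arbitrary: x rule: less_induct)
  case less
  note x = less.prems(1) and fx = less.prems(2)
  show ?case
  proof (cases "x = \<one>")
    case True
    have "act (bvec \<one>) (bvec \<one>) = bvec \<one>" by simp
    then show ?thesis using True by (simp only: bvec_def) simp
  next
    case False
    obtain s where s: "s \<in> S" "len x = Suc (len (s \<otimes> x))" using exists_left_descent[OF x False] .
    define J where "J = {s, star s}"
    have J: "J \<subseteq> S" "star ` J \<subseteq> J" using s by (auto simp: J_def star_star)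
    note pc = parabolic_carrier[OF J(1)]
    obtain w0 where w0: "w0 \<in> parabolic J" "\<And>w. w \<in> parabolic J \<Longrightarrow> len (w0 \<otimes> x) \<le> len (w \<otimes> x)"
      using ex_has_least_nat[of "\<lambda>w. w \<in> parabolic J" \<one> "\<lambda>w. len (w \<otimes> x)"] by auto
    define y where "y = w0 \<otimes> x"
    define d where "d = inv w0"
    have y: "y \<in> carrier W" using w0 pc x by (simp add: y_def)
    have d: "d \<in> parabolic J" "d \<in> carrier W" using w0 parabolic_inv[OF J(1)] pc by (auto simp: d_def)
    have xd: "x = d \<otimes> y" using w0 pc x by (simp add: d_def y_def flip: m_assoc)
    have min: "len y \<le> len (w \<otimes> y)" if "w \<in> parabolic J" for w
      using w0(2)[of "w \<otimes> w0"] parabolic_mult[OF J(1) that w0(1)] pc[OF that] pc[OF w0(1)] x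
      by (simp add: y_def m_assoc)
    have add: "len (w \<otimes> y) = len w + len y" if "w \<in> parabolic J" for w
      using len_minimal_coset[OF J(1) y _ that] min by blast
    have lx: "len x = len d + len y" using add[OF d(1)] xd by simp
    have fy: "star y = y"
    proof -
      define e where "e = star w0 \<otimes> d"
      have e: "e \<in> parabolic J" "e \<in> carrier W"
        using star_parabolic[OF J w0(1)] d(1) parabolic_mult[OF J(1)] pc by (simp_all add: e_def)
      have "star y = star w0 \<otimes> x" using w0 pc x fx by (simp add: y_def)
      also have "\<dots> = e \<otimes> y" using w0 pc d y xd by (simp add: e_def m_assoc)
      finally have ey: "star y = e \<otimes> y" .
      \<comment> \<open>\<open>star y\<close> lies in the coset of y and has the length of y, while
        lengths add in that coset.\<close>
      then have "len e = 0" using add[OF e(1)] len_star[OF y] by simp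
      then show ?thesis using ey len_eq_0[OF e(2)] y by simp
    qed
    have fd: "star d = d"
    proof -
      have "star d \<otimes> y = d \<otimes> y" using fx fy xd d y by (metis star_mult)
      then show ?thesis using d y by simp
    qed
    \<comment> \<open>Otherwise x would be minimal in its coset, although \<open>s\<close> is a
      descent of x. This makes the induction on the length proceed.\<close>
    have dn: "d \<noteq> \<one>"
    proof
      assume "d = \<one>"
      then have "x = y" using xd y by simp
      then show False using min[of s] s parabolic_gen[OF J(1), of s] by (simp add: J_def)
    qed
    then have ly: "len y < len x" using lx len_eq_0[OF d(2)] by simp
    obtain ws where ws: "ws \<in> lists J" "reduced ws" "word_prod W ws = d" using parabolic_reduced[OF J(1) d(1)] .
    then obtain c vs where cv: "ws = c # vs" using dn by (cases ws) auto
    define m where "m = length ws"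
    have c: "c \<in> S" "c = s \<or> c = star s" using ws cv J by (auto simp: J_def)
    have "set vs \<subseteq> {c, star c}" using ws cv c s by (auto simp: in_lists_conv_set J_def star_star)
    then have da: "d = alt c m" using reduced_alt[of c vs] ws cv c by (simp add: m_def)
    have dm: "len (alt c m) = m" using ws da by (simp add: reduced_def m_def)
    have td: "act (bvec d) (bvec \<one>) \<one> = u ^ len d"
      using coeff_one_dihedral[OF c(1) _ dm] star_alt[OF c(1), of m] fd da dm by simp
    define v where "v = act (bvec y) (bvec \<one>)"
    have v: "v \<in> Ms" using y by (simp add: v_def)
    have v1: "v \<one> = u ^ len y" using less.hyps[OF ly y fy] by (simp add: v_def)
    have loc: "v z = (v \<one> *q bvec \<one>) z" if z: "z \<in> parabolic J" for z
    proof (cases "z = \<one>")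
      case True
      then show ?thesis by (simp add: bvec_def)
    next
      case False
      have zc: "z \<in> carrier W" using pc z .
      have "len (inv y \<otimes> z) = len (inv z \<otimes> y)" using len_inv[of "inv z \<otimes> y"] zc y by (simp add: inv_mult_group)
      then have "len (inv y \<otimes> z) = len y + len z" using add[OF parabolic_inv[OF J(1) z]] zc by simp
      then have "tw_square y z = u ^ (2 * len y) * bvec (inv y) (inv y \<otimes> z)"
        using T_coeff_length_additive[of y z "bvec (inv y)"] y zc fy by (simp add: tw_square_def)
      also have "\<dots> = 0" using False y zc by (auto simp: bvec_def)
      finally have "v z = 0" using act_support[OF y] by (metis v_def less_irrefl)
      then show ?thesis using False by (simp add: bvec_def)
    qed
    have vm: "v \<one> *q bvec \<one> \<in> Ms" by simp
    have "act (bvec x) (bvec \<one>) \<one> = act (bvec d) v \<one>"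
      using act_T_mult[of d y "bvec \<one>"] d y xd lx by (simp add: v_def)
    also have "\<dots> = act (bvec d) (v \<one> *q bvec \<one>) \<one>"
      using vm by (rule act_parabolic_local[OF J v _ loc d(1) parabolic_one])
    also have "\<dots> = u ^ len x" using d td v1 lx by (simp add: act_scal power_add)
    finally show ?thesis .
  qed
qed

lemma muf_one: "muf (bvec \<one>) = X_elt W S star"
proof
  fix x
  show "muf (bvec \<one>) x = X_elt W S star x"
  proof (cases "x \<in> carrier W")
    case x: True
    show ?thesis
    proof (cases "star x = x")
      case True
      then have "act (bvec (inv x)) (bvec \<one>) \<one> = u ^ len x"
        using coeff_one_fixed[of "inv x"] x by simp
      then show ?thesis using x True by (simp add: muf_def X_elt_def mult_2 power_add field_simps)
    next
      case False
      then have "star (inv x) \<noteq> inv x" using x by (metis inv_inv star_closed star_inv)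
      then show ?thesis using coeff_one_nonfixed[of "inv x"] x False by (simp add: muf_def X_elt_def)
    qed
  qed (simp add: muf_def X_elt_def)
qed

end


section \<open>Leading coefficients\<close>

context hecke_involution_module
begin

section \<open>The recursion along left multiplication and its limit\<close>

lemma muf_scal: "v \<in> Ms \<Longrightarrow> muf (c *q v) = c *q muf v"
  by (auto simp: muf_def fun_eq_iff act_scal)

lemma muf_zero: "muf 0 = 0"
  by (auto simp: muf_def fun_eq_iff)

text \<open>The letter \<open>s\<close> passes from the index to the module, as the basis element of
  (s v)^-1 is T_(v^-1) T_s. The factor u^-2 is the change in the normalization u^(-2 l).\<close>

lemma muf_step:
  assumes s: "s \<in> S" and v: "v \<in> carrier W" and a: "asc s v" and w: "w \<in> I"
  shows "muf (bvec w) (s \<otimes> v) = (inverse u)\<^sup>2 * diag_coeff s w * muf (bvec w) v +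
    (inverse u)\<^sup>2 * off_coeff s w * muf (bvec (tconj s w)) v"
proof -
  have l: "len (s \<otimes> v) = Suc (len v)" using s v a asc_iff by simp
  have e: "inv (s \<otimes> v) = inv v \<otimes> s" using s v by (simp add: inv_mult_group)
  have "len (inv v \<otimes> s) = len (inv v) + len s" using len_inv[of "s \<otimes> v"] s v l e by simp
  then have "act (bvec (inv (s \<otimes> v))) (bvec w) = act (bvec (inv v)) (act (bvec s) (bvec w))"
    using act_T_mult[of "inv v" s "bvec w"] s v w e by simp
  also have "\<dots> = diag_coeff s w *q act (bvec (inv v)) (bvec w) +
      off_coeff s w *q act (bvec (inv v)) (bvec (tconj s w))"
    using s v w by (simp add: act_bvec act_add_right act_scal)
  finally show ?thesis using s v l by (simp add: muf_def power2_eq_square algebra_simps)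
qed

text \<open>At u^-1 = 0 the commuting and the noncommuting case become equal: both entries are 0 at
  an ascent and 1 at a descent.\<close>

lemma uinv_val_coeffs:
  "uinv_val ((inverse u)\<^sup>2 * diag_coeff s w) (if asc s w then 0 else 1)"
  "uinv_val ((inverse u)\<^sup>2 * off_coeff s w) (if asc s w then 0 else 1)"
proof -
  define e where "e = inverse u"
  have e: "uinv_val e 0" using uinv_val_inverse_u by (simp add: e_def)
  have e2: "uinv_val (e\<^sup>2) 0" using uinv_val_mult[OF e e] by (simp add: power2_eq_square)
  have one: "uinv_val 1 1" and zero: "uinv_val 0 0"
    using uinv_val_of_int[of 1] uinv_val_of_int[of 0] by simp_all
  have eu: "e * u = 1" by (simp add: e_def)
  have eu2: "e\<^sup>2 * u\<^sup>2 = 1" "e\<^sup>2 * u = e"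
    using power_mult_distrib[of e u 2] eu by (simp_all add: power2_eq_square mult.assoc)
  have 1: "uinv_val (e\<^sup>2 * (u\<^sup>2 - u - 1)) 1"
    using uinv_val_diff[OF uinv_val_diff[OF one e] e2] by (simp add: right_diff_distrib eu2)
  have 2: "uinv_val (e\<^sup>2 * (u\<^sup>2 - 1)) 1" "uinv_val (e\<^sup>2 * (u\<^sup>2 - u)) 1" "uinv_val (e\<^sup>2 * (u + 1)) 0"
    using uinv_val_diff[OF one e2] uinv_val_diff[OF one e] uinv_val_add[OF e e2]
    by (simp_all add: right_diff_distrib distrib_left eu2)
  show "uinv_val ((inverse u)\<^sup>2 * diag_coeff s w) (if asc s w then 0 else 1)"
    "uinv_val ((inverse u)\<^sup>2 * off_coeff s w) (if asc s w then 0 else 1)"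
    using 1 2 e e2 one zero eu2 by (auto simp: diag_coeff_def off_coeff_def simp flip: e_def)
qed

text \<open>Combines integrality of the whole family at \<open>x\<close> with its leading
  coefficients, so that one induction yields both.\<close>

definition is_pi :: "'a \<Rightarrow> 'a \<Rightarrow> bool" where
  "is_pi x z \<longleftrightarrow> z \<in> I \<and> (\<forall>w\<in>I. uinv_val (muf (bvec w) x) (if w = z then 1 else 0))"

lemma is_pi_unique: "is_pi x z \<Longrightarrow> is_pi x z' \<Longrightarrow> z = z'"
  unfolding is_pi_def using uinv_val_eval by (metis zero_neq_one)

lemma is_pi_one: "is_pi \<one> \<one>"
proof -
  have "muf (bvec w) \<one> = of_int (if w = \<one> then 1 else 0)" if "w \<in> I" for w
    using that by (simp add: muf_def) (simp add: bvec_def)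
  then show ?thesis using uinv_val_of_int by (simp add: is_pi_def del: of_int_eq_iff)
qed

text \<open>\<open>\<pi> (s v)\<close> arises from \<open>\<pi> v\<close> by the monoid action of Demazure (0-Hecke) type.\<close>

lemma is_pi_step:
  assumes s: "s \<in> S" and v: "v \<in> carrier W" and a: "asc s v" and p: "is_pi v z"
  shows "is_pi (s \<otimes> v) (if asc s z then tconj s z else z)"
proof -
  define y where "y = (if asc s z then tconj s z else z)"
  have z: "z \<in> I" using p by (simp add: is_pi_def)
  have "uinv_val (muf (bvec w) (s \<otimes> v)) (if w = y then 1 else 0)" if w: "w \<in> I" for w
  proof -
    define k :: int where "k = (if asc s w then 0 else 1)"
    have "uinv_val (muf (bvec w) v) (if w = z then 1 else 0)"
      "uinv_val (muf (bvec (tconj s w)) v) (if tconj s w = z then 1 else 0)"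
      using p s w by (simp_all add: is_pi_def)
    then have "uinv_val (muf (bvec w) (s \<otimes> v))
        (k * (if w = z then 1 else 0) + k * (if tconj s w = z then 1 else 0))"
      unfolding muf_step[OF s v a w] k_def
      by (intro uinv_val_add uinv_val_mult uinv_val_coeffs)
    moreover have "tconj s w = z \<longleftrightarrow> w = tconj s z" using s w z by auto
    moreover have "k * (if w = z then 1 else 0) + k * (if w = tconj s z then 1 else 0) =
        (if w = y then 1 else 0)"
      using asc_tconj[OF s z] tconj_neq[OF s z] by (auto simp: k_def y_def)
    ultimately show ?thesis by simp
  qed
  then show ?thesis using s z by (auto simp: is_pi_def y_def)
qed

lemma is_pi_exists: "x \<in> carrier W \<Longrightarrow> \<exists>z. is_pi x z"
proof (induction x rule: left_mult_induct)
  case one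
  show ?case using is_pi_one by blast
next
  case (step s v)
  then show ?case using is_pi_step by blast
qed

text \<open>The last step of the recursion ends in an element with descent \<open>s\<close>: either
  it has just gone up by \<open>s\<close>, or \<open>s\<close> was a descent already.\<close>

lemma is_pi_descent:
  assumes s: "s \<in> S" and x: "x \<in> carrier W" and d: "\<not> asc s x" and p: "is_pi x z"
  shows "\<not> asc s z"
proof -
  define v where "v = s \<otimes> x"
  have v: "v \<in> carrier W" "s \<otimes> v = x" "asc s v"
    using s x d asc_mult[of s x] by (simp_all add: v_def)
  obtain y where y: "is_pi v y" using is_pi_exists v by blast
  have "z = (if asc s y then tconj s y else y)"
    using is_pi_unique[OF p] is_pi_step[OF s v(1,3) y] v(2) by simp
  then show ?thesis using asc_tconj[OF s, of y] y by (simp add: is_pi_def)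
qed

text \<open>An ascent of v is an ascent of every x lying over v, so a chain of ascending twisted
  conjugations lifts to W.\<close>

lemma is_pi_surj: "z \<in> I \<Longrightarrow> \<exists>x\<in>carrier W. is_pi x z"
proof (induction z rule: I_induct)
  case one
  show ?case using is_pi_one by blast
next
  case (tconj s v)
  then obtain x where x: "x \<in> carrier W" "is_pi x v" by blast
  have "asc s x" using is_pi_descent[OF tconj(1) x(1) _ x(2)] tconj(3) by blast
  then have "is_pi (s \<otimes> x) (tconj s v)" using is_pi_step[OF tconj(1) x(1) _ x(2)] tconj(3) by simp
  then show ?case using x tconj(1) by (intro bexI[of _ "s \<otimes> x"]) auto
qed

text \<open>If \<open>|v z\<^sub>0|\<close> is maximal and \<open>\<pi> x = z\<^sub>0\<close>, then \<open>v z\<^sub>0\<close> dominates the coefficient of \<open>\<mu> v\<close> at \<open>x\<close>, because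
  \<open>u\<close> is infinitely large in the ordered field.\<close>

lemma muf_eq_0:
  assumes v: "v \<in> Ms" and m: "muf v = 0"
  shows "v = 0"
proof (rule ccontr)
  assume "v \<noteq> 0"
  define A where "A = {z. v z \<noteq> 0}"
  have A: "finite A" "A \<noteq> {}" "A \<subseteq> I"
    using v \<open>v \<noteq> 0\<close> by (auto simp: A_def finite_sums_def formal_sums_def fun_eq_iff)
  define b where "b = Max ((\<lambda>z. \<bar>v z\<bar>) ` A)"
  have "b \<in> (\<lambda>z. \<bar>v z\<bar>) ` A" using A by (simp add: b_def)
  then obtain z where z: "z \<in> A" "\<bar>v z\<bar> = b" by blast
  have bmax: "\<bar>v w\<bar> \<le> b" if "w \<in> A" for w using A that by (simp add: b_def)
  have b: "0 < b" using z by (auto simp: A_def)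
  obtain x where x: "x \<in> carrier W" "is_pi x z" using is_pi_surj z A by blast
  define \<delta> :: "'a \<Rightarrow> int" where "\<delta> w = (if w = z then 1 else 0)" for w
  define n where "n = card A"
  have n: "n > 0" using A by (simp add: n_def card_gt_0_iff)
  \<comment> \<open>The n error terms are at most b e each, so e = 1/(2 n) bounds their sum by
    b/2.\<close>
  define e :: Qu where "e = inverse (of_nat (2 * n))"
  have near: "\<bar>muf (bvec w) x - of_int (\<delta> w)\<bar> \<le> e" if "w \<in> A" for w
  proof -
    have "uinv_val (muf (bvec w) x) (\<delta> w)" using x(2) subsetD[OF A(3) that] by (simp add: is_pi_def \<delta>_def)
    then show ?thesis
      unfolding e_def using n by (intro less_imp_le uinv_val_near) simp_all
  qed
  have "muf v x = (\<Sum>w\<in>A. v w * muf (bvec w) x)"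
    using A v by (intro linear_expand[of A I v "\<lambda>f. muf f x"]) (auto simp: A_def muf_zero muf_add muf_scal)
  then have 0: "(\<Sum>w\<in>A. v w * muf (bvec w) x) = 0" using m by simp
  have "(\<Sum>w\<in>A. v w * of_int (\<delta> w)) = (\<Sum>w\<in>A. if w = z then v w else 0)"
    by (intro sum.cong) (auto simp: \<delta>_def)
  also have "\<dots> = v z" using A z by simp
  finally have "v z = - (\<Sum>w\<in>A. v w * (muf (bvec w) x - of_int (\<delta> w)))"
    using 0 by (simp add: right_diff_distrib sum_subtractf)
  then have "b = \<bar>\<Sum>w\<in>A. v w * (muf (bvec w) x - of_int (\<delta> w))\<bar>" using z by simp
  also have "\<dots> \<le> (\<Sum>w\<in>A. \<bar>v w * (muf (bvec w) x - of_int (\<delta> w))\<bar>)" by (rule sum_abs)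
  also have "\<dots> \<le> (\<Sum>w\<in>A. b * e)"
    unfolding abs_mult using bmax near b by (intro sum_mono mult_mono) auto
  also have "\<dots> = b * (of_nat n * e)" by (simp add: n_def)
  also have "of_nat n * e = 1 / 2" using n by (simp add: e_def field_simps)
  finally show False using b by simp
qed

section \<open>Injectivity, image and uniqueness of the linear map\<close>

lemma muf_inj: "inj_on muf Ms"
proof (rule inj_onI)
  fix v w assume vw: "v \<in> Ms" "w \<in> Ms" "muf v = muf w"
  have "muf (v + (-1) *q w) = muf v + (-1) *q muf w" using vw(1,2) by (simp only: muf_add muf_scal finite_sums_scal)
  also have "\<dots> = 0" unfolding vw(3) by (rule ext) simp
  finally have "muf (v + (-1) *q w) = 0" .
  with vw(1,2) have 0: "v + (-1) *q w = 0" by (simp add: muf_eq_0)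
  show "v = w"
  proof
    fix x
    show "v x = w x" using fun_cong[OF 0, of x] by simp
  qed
qed

text \<open>Since a_1 generates M, every value of \<open>muf\<close> is h X for some h and lies in
  each submodule containing X.\<close>

lemma muf_image:
  "hecke_submodule H (formal_sums (carrier W)) (hat_act W H) hull {X_elt W S star} = muf ` Ms"
proof (rule hull_unique)
  show "{X_elt W S star} \<subseteq> muf ` Ms" using muf_one by (metis empty_subsetI finite_sums_bvec imageI insert_subset one_in_I)
  have "hat_act W H h (muf v) \<in> muf ` Ms" if "h \<in> Hs" "v \<in> Ms" for h v
    using that muf_act[of h v] by (metis act_closed imageI)
  moreover have "muf v + muf w \<in> muf ` Ms" if "v \<in> Ms" "w \<in> Ms" for v w
    using that muf_add[of v w] by (metis finite_sums_add imageI)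
  moreover have "0 \<in> muf ` Ms" using muf_zero by (metis finite_sums_0 imageI)
  ultimately show "hecke_submodule H (formal_sums (carrier W)) (hat_act W H) (muf ` Ms)"
    using muf_formal by (auto simp: hecke_submodule_def carrier_H)
next
  fix U assume X: "{X_elt W S star} \<subseteq> U" and U: "hecke_submodule H (formal_sums (carrier W)) (hat_act W H) U"
  show "muf ` Ms \<subseteq> U"
  proof
    fix f assume "f \<in> muf ` Ms"
    then obtain v where v: "v \<in> Ms" "f = muf v" by blast
    obtain h where h: "h \<in> Hs" "act h (bvec \<one>) = v" using M_cyclic[OF v(1)] by blast
    then have "f = hat_act W H h (X_elt W S star)" using muf_act[of h "bvec \<one>"] v muf_one by simp
    then show "f \<in> U" using U X h by (simp add: hecke_submodule_def carrier_H)
  qed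
qed

lemma linear_map_eq_muf:
  assumes "\<mu> \<in> hecke_linear_maps H Ms act (formal_sums (carrier W)) (hat_act W H)"
    and "\<mu> (bvec \<one>) = X_elt W S star"
  shows "\<mu> = restrict muf Ms"
proof (rule extensionalityI[of _ Ms])
  show "\<mu> \<in> extensional Ms" using assms by (simp add: hecke_linear_maps_def PiE_iff)
  show "restrict muf Ms \<in> extensional Ms" by simp
  fix v assume v: "v \<in> Ms"
  obtain h where h: "h \<in> Hs" "act h (bvec \<one>) = v" using M_cyclic[OF v] by blast
  have "\<mu> v = hat_act W H h (\<mu> (bvec \<one>))"
    using assms(1) h by (auto simp: hecke_linear_maps_def carrier_H)
  also have "\<dots> = muf v" using muf_act[of h "bvec \<one>"] assms(2) muf_one h by simp
  finally show "\<mu> v = restrict muf Ms v" using v by simp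
qed

lemma muf_linear_map:
  "restrict muf Ms \<in> hecke_linear_maps H Ms act (formal_sums (carrier W)) (hat_act W H)"
  using muf_formal by (simp add: hecke_linear_maps_def carrier_H muf_add muf_act)

lemma exists_unique_pi:
  "\<exists>!\<pi>. \<pi> \<in> carrier W \<rightarrow>\<^sub>E I \<and> \<pi> ` carrier W = I \<and>
     (\<forall>x\<in>carrier W. \<forall>z\<in>I.
        (z = \<pi> x \<longrightarrow> eval_uinv_0 (muf (bvec z) x) = 1) \<and>
        (z \<noteq> \<pi> x \<longrightarrow> eval_uinv_0 (muf (bvec z) x) = 0))"
proof -
  define p where "p = restrict (\<lambda>x. SOME z. is_pi x z) (carrier W)"
  have p: "is_pi x (p x)" if "x \<in> carrier W" for x
    using someI_ex[OF is_pi_exists[OF that]] that by (simp add: p_def)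
  have val: "eval_uinv_0 (muf (bvec z) x) = (if z = p x then 1 else 0)" if "x \<in> carrier W" "z \<in> I" for x z
    using p[OF that(1)] that(2) by (intro uinv_val_eval) (simp add: is_pi_def)
  have pI: "p \<in> carrier W \<rightarrow>\<^sub>E I" using p by (auto simp: p_def is_pi_def)
  have "I \<subseteq> p ` carrier W"
    using is_pi_surj is_pi_unique p by (metis imageI subsetI)
  then have "p ` carrier W = I" using pI by auto
  then show ?thesis
  proof (intro ex1I[of _ p] conjI)
    fix q assume q: "q \<in> carrier W \<rightarrow>\<^sub>E I \<and> q ` carrier W = I \<and>
     (\<forall>x\<in>carrier W. \<forall>z\<in>I.
        (z = q x \<longrightarrow> eval_uinv_0 (muf (bvec z) x) = 1) \<and>
        (z \<noteq> q x \<longrightarrow> eval_uinv_0 (muf (bvec z) x) = 0))"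
    show "q = p"
    proof (rule PiE_ext)
      show "q \<in> carrier W \<rightarrow>\<^sub>E I" "p \<in> carrier W \<rightarrow>\<^sub>E I" using q pI by auto
      fix x assume x: "x \<in> carrier W"
      have qx: "q x \<in> I" using q x by auto
      then have "eval_uinv_0 (muf (bvec (q x)) x) = 1" using q x by blast
      then show "q x = p x" using val[OF x qx] by (auto split: if_splits)
    qed
  qed (use pI val in auto)
qed

end


theorem theorem0p2:
  fixes W :: "('w, 'b) monoid_scheme"
    and S :: "'w set"
    and star :: "'w \<Rightarrow> 'w"
    and H :: "('w \<Rightarrow> Qu, 'c) ring_scheme"
    and actM :: "('w \<Rightarrow> Qu) \<Rightarrow> ('w \<Rightarrow> Qu) \<Rightarrow> 'w \<Rightarrow> Qu"
  defines "I \<equiv> twisted_involutions W star"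
    and "M \<equiv> finite_sums (twisted_involutions W star)"
    and "Hhat \<equiv> formal_sums (carrier W)"
    and "X \<equiv> X_elt W S star"
  assumes "coxeter_system W S"
    and "star \<in> iso W W"
    and "star ` S = S"
    and "\<forall>w\<in>carrier W. star (star w) = w"
    and "hecke_algebra W S H"
    and "involution_module W S star H actM"
  shows
    "(\<exists>!\<mu>. \<mu> \<in> hecke_linear_maps H M actM Hhat (hat_act W H) \<and> \<mu> (bvec \<one>\<^bsub>W\<^esub>) = X) \<and>
     (\<forall>\<mu>. \<mu> \<in> hecke_linear_maps H M actM Hhat (hat_act W H) \<and> \<mu> (bvec \<one>\<^bsub>W\<^esub>) = X \<longrightarrow>
        bij_betw \<mu> M (hecke_submodule H Hhat (hat_act W H) hull {X}) \<and>
        (\<forall>z\<in>I. \<forall>x\<in>carrier W. \<mu> (bvec z) x \<in> Z_uinv) \<and>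
        (\<exists>!\<pi>. \<pi> \<in> carrier W \<rightarrow>\<^sub>E I \<and> \<pi> ` carrier W = I \<and>
           (\<forall>x\<in>carrier W. \<forall>z\<in>I.
              (z = \<pi> x \<longrightarrow> eval_uinv_0 (\<mu> (bvec z) x) = 1) \<and>
              (z \<noteq> \<pi> x \<longrightarrow> eval_uinv_0 (\<mu> (bvec z) x) = 0))))"
proof -
  interpret hecke_involution_module W S star H actM
    using assms(5-10)
    by (intro hecke_involution_module.intro twisted_coxeter.intro
        twisted_coxeter_axioms.intro hecke_involution_module_axioms.intro) auto
  let ?\<mu> = "restrict muf Ms"
  have one: "?\<mu> (bvec \<one>\<^bsub>W\<^esub>) = X_elt W S star" using muf_one by simp
  have bvec: "?\<mu> (bvec z) = muf (bvec z)" if "z \<in> twisted_involutions W star" for z using that by simp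
  have "bij_betw ?\<mu> Ms (hecke_submodule H (formal_sums (carrier W)) (hat_act W H) hull {X_elt W S star})"
    unfolding muf_image using muf_inj by (simp add: bij_betw_def inj_on_def)
  moreover have "\<forall>z\<in>twisted_involutions W star. \<forall>x\<in>carrier W. ?\<mu> (bvec z) x \<in> Z_uinv"
    using is_pi_exists uinv_val_Z_uinv by (metis bvec is_pi_def)
  moreover note exists_unique_pi
  \<comment> \<open>Every map as in the statement equals the restriction of \<open>muf\<close>, so
    its properties are those already shown.\<close>
  ultimately show ?thesis
    unfolding I_def M_def Hhat_def X_def
    using muf_linear_map one linear_map_eq_muf bvec by (smt (verit))
qed

end
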